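(* Let $m,n,k\ge 0$ be integers. The evaluation in $\mathcal{S}(S^2)\cong\mathbb{Q}(A)$ of the theta graph $\Lambda(m,n,k)$ is $$\Lambda(m,n,k)=\left\lceil\begin{array}{cc} m&n\\ k&k\end{array}\right\rceil_0\,\Delta_{m+n}.$$
   Context: All skein modules are Kauffman bracket skein modules over $\mathbb{Q}(A)$, with relations: crossing $=A\cdot(A\text{-smoothing})+A^{-1}\cdot(B\text{-smoothing})$, and $L\sqcup\text{(trivial circle)}=-(A^2+A^{-2})L$. $\mathcal{S}(S^2)$ is identified with $\mathbb{Q}(A)$ by sending the empty link to $1$. Put $\Delta_n=(-1)^n\frac{A^{2(n+1)}-A^{-2(n+1)}}{A^2-A^{-2}}$. $f^{(n)}$ is the $n$-th Jones–Wenzl idempotent in the Temperley–Lieb algebra $TL_n$ with loop value $-(A^2+A^{-2})$. $\Lambda(m,n,k)$ is the standard theta network in $S^2$: two trivalent vertices joined by three edges carrying the idempotents $f^{(m+n)}$, $f^{(m+k)}$, $f^{(n+k)}$, where at each of the two vertices, $m$ strands join $f^{(m+n)}$ to $f^{(m+k)}$, $n$ strands join $f^{(m+n)}$ to $f^{(n+k)}$, and $k$ strands join $f^{(m+k)}$ to $f^{(n+k)}$, all without crossings. For $k\ge l$ and $0\le i\le\min(m,n,l)$, $$\left\lceil\begin{array}{cc} m&n\\ k&l\end{array}\right\rceil_i:=(-A^2)^{i(i-l)}\,\frac{\prod_{j=0}^{l-i-1}\Delta_{k-j-1}\prod_{s=0}^{i-1}\Delta_{n-s-1}\Delta_{m-s-1}}{\prod_{t=0}^{l-1}\Delta_{n+k-t-1}\Delta_{m+k-t-1}}{l\brack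 i}_{A^4}\prod_{j=0}^{l-i-1}\Delta_{m+n+k-i-j},$$ where ${l\brack i}_q=\frac{(q;q)_l}{(q;q)_i(q;q)_{l-i}}$, $(a;q)_n=\prod_{j=0}^{n-1}(1-aq^j)$, and empty products are $1$. *)

theory Defs
  imports
    "HOL-Library.Poly_Mapping"
    "HOL-Computational_Algebra.Polynomial"
    "HOL-Computational_Algebra.Fraction_Field"
begin

section \<open>The coefficient field and the coefficients\<close>

type_synonym qA = "rat poly fract"

definition Avar :: qA where
  "Avar = Fract [:0, 1:] 1"

text \<open>The index is an integer, so that the subtractions in the indices below do not truncate.\<close>

definition Delta :: "int \<Rightarrow> qA" where
  "Delta n = (-1) powi n * (Avar powi (2 * (n + 1)) - Avar powi (- 2 * (n + 1)))
                / (Avar powi 2 - Avar powi (- 2))"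

definition loop_value :: qA where
  "loop_value = - (Avar powi 2 + Avar powi (- 2))"

definition q_pochhammer :: "'a::field \<Rightarrow> 'a \<Rightarrow> nat \<Rightarrow> 'a" where
  "q_pochhammer a q n = (\<Prod>j<n. 1 - a * q ^ j)"

definition q_binomial :: "'a::field \<Rightarrow> nat \<Rightarrow> nat \<Rightarrow> 'a" where
  "q_binomial q l i = q_pochhammer q q l / (q_pochhammer q q i * q_pochhammer q q (l - i))"

text \<open>The symbol with rows \<open>m n\<close> and \<open>k l\<close> and subscript \<open>i\<close>; it is only meaningful for
  \<open>l \<le> k\<close> and \<open>i \<le> min m (min n l)\<close>.\<close>

definition ceil_symbol :: "nat \<Rightarrow> nat \<Rightarrow> nat \<Rightarrow> nat \<Rightarrow> nat \<Rightarrow> qA" where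
  "ceil_symbol m n k l i =
     (- (Avar ^ 2)) powi (int i * (int i - int l))
     * (((\<Prod>j<l - i. Delta (int k - int j - 1))
          * (\<Prod>s<i. Delta (int n - int s - 1) * Delta (int m - int s - 1)))
        / (\<Prod>t<l. Delta (int n + int k - int t - 1) * Delta (int m + int k - int t - 1)))
     * q_binomial (Avar ^ 4) l i
     * (\<Prod>j<l - i. Delta (int m + int n + int k - int i - int j))"


section \<open>Tangle diagrams\<close>

text \<open>
  Unoriented framed tangle diagrams (blackboard framing) in general position with respect to the
  height function are stacks of slices, read from bottom to top.  A slice \<open>(i, g)\<close> consists of one
  piece \<open>g\<close> with \<open>i\<close> vertical strands on its left; all remaining strands are vertical on
  its right.  Thus the same word describes a tangle and the same tangle with additional vertical
  strands on its right, and the empty word describes the identity on any number of strands; the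
  numbers of end points are supplied by \<open>is_tangle\<close>.

  The over-strand goes from bottom left to top right in \<open>CrossR\<close> and from bottom right to
  top left in \<open>CrossL\<close>.
\<close>

datatype piece = Cup | Cap | CrossR | CrossL

fun bot_ends :: "piece \<Rightarrow> nat" where
  "bot_ends Cup = 0" | "bot_ends Cap = 2" | "bot_ends CrossR = 2" | "bot_ends CrossL = 2"

fun top_ends :: "piece \<Rightarrow> nat" where
  "top_ends Cup = 2" | "top_ends Cap = 0" | "top_ends CrossR = 2" | "top_ends CrossL = 2"

type_synonym slice = "nat \<times> piece"

datatype diagram = Diagram (slices: "slice list")

fun is_tangle_word :: "nat \<Rightarrow> slice list \<Rightarrow> nat \<Rightarrow> bool" where
  "is_tangle_word m [] n \<longleftrightarrow> m = n"
| "is_tangle_word m ((i, g) # w) n \<longleftrightarrow>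
     i + bot_ends g \<le> m \<and> is_tangle_word (m - bot_ends g + top_ends g) w n"

definition is_tangle :: "nat \<Rightarrow> diagram \<Rightarrow> nat \<Rightarrow> bool" where
  "is_tangle m d n \<longleftrightarrow> is_tangle_word m (slices d) n"

text \<open>\<open>d + e\<close> is \<open>e\<close> stacked on top of \<open>d\<close>.\<close>

instantiation diagram :: monoid_add
begin
definition zero_diagram :: diagram where
  "zero_diagram = Diagram []"
definition plus_diagram :: "diagram \<Rightarrow> diagram \<Rightarrow> diagram" where
  "plus_diagram d e = Diagram (slices d @ slices e)"
instance
  by standard (simp_all add: zero_diagram_def plus_diagram_def)
end

text \<open>\<open>a\<close> additional vertical strands on the left.\<close>

definition shift_diagram :: "nat \<Rightarrow> diagram \<Rightarrow> diagram" where
  "shift_diagram a d = Diagram (map (\<lambda>(i, g). (a + i, g)) (slices d))"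


section \<open>Formal linear combinations of diagrams\<close>

text \<open>Multiplication of \<open>\<Rightarrow>\<^sub>0\<close> is the bilinear extension of stacking, with unit the identity
  diagram.\<close>

type_synonym comb = "diagram \<Rightarrow>\<^sub>0 qA"

definition of_word :: "slice list \<Rightarrow> comb" where
  "of_word w = Poly_Mapping.single (Diagram w) 1"

definition scale :: "qA \<Rightarrow> comb \<Rightarrow> comb" where
  "scale c x = Poly_Mapping.single 0 c * x"

global_interpretation comb: vector_space scale
proof
  fix a b :: qA and x y :: comb
  show "scale a (x + y) = scale a x + scale a y"
    by (simp add: scale_def distrib_left)
  show "scale (a + b) x = scale a x + scale b x"
    by (simp add: scale_def single_add distrib_right)
  show "scale a (scale b x) = scale (a * b) x"
    by (simp add: scale_def mult_single flip: mult.assoc)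
  show "scale 1 x = x"
    by (simp add: scale_def)
qed

definition shift :: "nat \<Rightarrow> comb \<Rightarrow> comb" where
  "shift a x = (\<Sum>d\<in>Poly_Mapping.keys x.
                  Poly_Mapping.single (shift_diagram a d) (Poly_Mapping.lookup x d))"

definition tangle_combs :: "nat \<Rightarrow> nat \<Rightarrow> comb set" where
  "tangle_combs m n = {x. \<forall>d\<in>Poly_Mapping.keys x. is_tangle m d n}"


section \<open>Skein modules\<close>

text \<open>
  Local moves generating isotopy of unoriented framed tangles: \<open>isotopy_move p q v w\<close> relates
  tangle words with \<open>p\<close> bottom and \<open>q\<close> top end points.  Besides planar isotopy (exchange of the
  heights of distant pieces, straightening of a strand) these are the second and third
  Reidemeister moves, the sliding of a strand over or under an extremum, and the framed
  first Reidemeister move, which equates the left and the right kink with the same crossing sign.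
\<close>

inductive isotopy_move :: "nat \<Rightarrow> nat \<Rightarrow> slice list \<Rightarrow> slice list \<Rightarrow> bool" where
  exchange: "isotopy_move (bot_ends g + c + bot_ends h) (top_ends g + c + top_ends h)
      [(0, g), (top_ends g + c, h)] [(bot_ends g + c, h), (0, g)]"
| straighten_left: "isotopy_move 1 1 [(0, Cup), (1, Cap)] []"
| straighten_right: "isotopy_move 1 1 [(1, Cup), (0, Cap)] []"
| reidemeister2_RL: "isotopy_move 2 2 [(0, CrossR), (0, CrossL)] []"
| reidemeister2_LR: "isotopy_move 2 2 [(0, CrossL), (0, CrossR)] []"
| reidemeister3: "isotopy_move 3 3
      [(0, CrossR), (1, CrossR), (0, CrossR)] [(1, CrossR), (0, CrossR), (1, CrossR)]"
| slide_cap_R: "isotopy_move 3 1 [(0, CrossR), (1, Cap)] [(1, CrossL), (0, Cap)]"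
| slide_cap_L: "isotopy_move 3 1 [(0, CrossL), (1, Cap)] [(1, CrossR), (0, Cap)]"
| slide_cup_R: "isotopy_move 1 3 [(1, Cup), (0, CrossR)] [(0, Cup), (1, CrossL)]"
| slide_cup_L: "isotopy_move 1 3 [(1, Cup), (0, CrossL)] [(0, Cup), (1, CrossR)]"
| kink_R: "isotopy_move 1 1
      [(1, Cup), (0, CrossR), (1, Cap)] [(0, Cup), (1, CrossR), (0, Cap)]"
| kink_L: "isotopy_move 1 1
      [(1, Cup), (0, CrossL), (1, Cap)] [(0, Cup), (1, CrossL), (0, Cap)]"

text \<open>The A-smoothing joins the two regions swept out by the over-strand when it is turned
  counterclockwise: this gives the identity for \<open>CrossR\<close>, and a cap below a cup for
  \<open>CrossL\<close>.\<close>

inductive local_relation :: "nat \<Rightarrow> nat \<Rightarrow> comb \<Rightarrow> bool" where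
  isotopy: "isotopy_move p q v w \<Longrightarrow> local_relation p q (of_word v - of_word w)"
| crossing_R: "local_relation 2 2 (of_word [(0, CrossR)]
      - (scale Avar (of_word []) + scale (inverse Avar) (of_word [(0, Cap), (0, Cup)])))"
| crossing_L: "local_relation 2 2 (of_word [(0, CrossL)]
      - (scale Avar (of_word [(0, Cap), (0, Cup)]) + scale (inverse Avar) (of_word [])))"
| circle: "local_relation 0 0 (of_word [(0, Cup), (0, Cap)] - scale loop_value (of_word []))"

text \<open>The skein module of the disk with \<open>m\<close> marked points at the bottom and \<open>n\<close> at the top is the
  quotient of \<open>tangle_combs m n\<close> by \<open>disk_relations m n\<close>; it is handled through representatives
  and the congruence \<open>skein_eq\<close>.\<close>

definition disk_relations :: "nat \<Rightarrow> nat \<Rightarrow> comb set" where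
  "disk_relations m n = comb.span
     {of_word u * shift a r * of_word w | u r w a b p q.
        local_relation p q r \<and> is_tangle_word m u (a + p + b) \<and> is_tangle_word (a + q + b) w n}"

definition skein_eq :: "nat \<Rightarrow> nat \<Rightarrow> comb \<Rightarrow> comb \<Rightarrow> bool" where
  "skein_eq m n x y \<longleftrightarrow> x - y \<in> disk_relations m n"

text \<open>In addition to the moves in the plane, an isotopy of link diagrams in the sphere can move an
  arc through the point at infinity.  Such an arc can be taken to be the arc closing up a tangle
  with one end point at the bottom and one at the top, so this adds the equality of the right
  and the left closure of such tangles.\<close>

definition sphere_relations :: "comb set" where
  "sphere_relations = comb.span
     (disk_relations 0 0 \<union>
      {of_word ([(0, Cup)] @ slices d @ [(0, Cap)])
         - of_word ([(0, Cup)] @ slices (shift_diagram 1 d) @ [(0, Cap)]) | d. is_tangle 1 d 1})"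

text \<open>The identification of the skein module of the sphere, that is, of
  \<open>tangle_combs 0 0\<close> modulo \<open>sphere_relations\<close>, with the field, sending the empty link
  \<open>1 = of_word []\<close> to \<open>1\<close>.\<close>

definition sphere_eval :: "comb \<Rightarrow> qA" where
  "sphere_eval x = (THE c. x - scale c 1 \<in> sphere_relations)"


section \<open>Jones--Wenzl idempotents\<close>

text \<open>The Temperley--Lieb algebra \<open>TL\<^sub>n\<close> is the skein module of the disk with \<open>n + n\<close> points.
  The generator \<open>tl_gen i\<close> acts on the strands \<open>i\<close> and \<open>i + 1\<close>, counted from \<open>0\<close>.\<close>

definition tl_gen :: "nat \<Rightarrow> comb" where
  "tl_gen i = of_word [(i, Cap), (i, Cup)]"

text \<open>Representatives of the elements of the non-unital subalgebra of \<open>TL\<^sub>n\<close> generated by the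
  generators.\<close>

definition tl_subalgebra :: "nat \<Rightarrow> comb set" where
  "tl_subalgebra n = comb.span {prod_list (map tl_gen is) | is. is \<noteq> [] \<and> (\<forall>i\<in>set is. i + 1 < n)}"

definition is_jones_wenzl :: "nat \<Rightarrow> comb \<Rightarrow> bool" where
  "is_jones_wenzl n f \<longleftrightarrow>
     f \<in> tangle_combs n n \<and>
     skein_eq n n (f * f) f \<and>
     (\<forall>i. i + 1 < n \<longrightarrow> skein_eq n n (tl_gen i * f) 0 \<and> skein_eq n n (f * tl_gen i) 0) \<and>
     (\<exists>u\<in>tl_subalgebra n. skein_eq n n f (1 + u))"

text \<open>These properties determine the class of \<open>f\<close> in \<open>TL\<^sub>n\<close>; we choose a representative.\<close>

definition jones_wenzl :: "nat \<Rightarrow> comb" where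
  "jones_wenzl n = (SOME f. is_jones_wenzl n f)"


section \<open>The theta network\<close>

text \<open>\<open>p\<close> nested arcs with \<open>a\<close> vertical strands on their left.\<close>

definition cups :: "nat \<Rightarrow> nat \<Rightarrow> comb" where
  "cups a p = of_word (map (\<lambda>j. (a + j, Cup)) [0..<p])"

definition caps :: "nat \<Rightarrow> nat \<Rightarrow> comb" where
  "caps a p = of_word (map (\<lambda>j. (a + j, Cap)) (rev [0..<p]))"

text \<open>The edges are vertical and carry, from left to right, the idempotents of index \<open>m + n\<close>,
  \<open>n + k\<close> and \<open>m + k\<close>.  Each vertex consists of \<open>m\<close> arcs joining the outer two edges around the
  middle one, \<open>n\<close> arcs joining the first and second and \<open>k\<close> arcs joining the second and third, so
  that the strands are grouped as \<open>m, n | n, k | k, m\<close>.\<close>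

definition theta :: "nat \<Rightarrow> nat \<Rightarrow> nat \<Rightarrow> comb" where
  "theta m n k =
     cups 0 m * cups m n * cups (m + 2 * n) k
     * (jones_wenzl (m + n) * shift (m + n) (jones_wenzl (n + k))
        * shift (m + 2 * n + k) (jones_wenzl (m + k)))
     * caps (m + 2 * n) k * caps m n * caps 0 m"

end

theory Submission
  imports Defs
begin

text \<open>
  Evaluation of closed diagrams is made computable by a representation on the tensor powers of a
  plane over the field, a strand being a tensor factor.  The cup and the cap are fixed by the loop
  value and the straightening relations, and the crossings by the skein relation.  All slices
  commute with the raising generator of quantum \<open>sl\<^sub>2\<close>; this forces tangles with one end point at
  either side to act with equal diagonal entries, so that the two closures in the sphere agree.
  Conversely, every closed diagram is skein equivalent to a multiple of the empty one, since the
  first cap of a crossingless word can be moved down until it meets a cup.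

  On tensor powers of the plane, with basis the binary words, the idempotent of index \<open>n\<close> is the
  projection whose entry at words \<open>r\<close>, \<open>s\<close> with \<open>w\<close> ones each is \<open>(Avar^2)^(inv r + inv s)\<close> divided
  by the Gaussian binomial coefficient of \<open>n\<close> over \<open>w\<close> in \<open>Avar^4\<close>, where \<open>inv\<close> counts inversions.
  The part of the theta network that closes up the edge of index \<open>m + n\<close> acts on the image of its
  idempotent by a scalar, by Schur's lemma, and the closure of the idempotent contributes
  \<open>Delta (m + n)\<close>.  The scalar is read off at an extremal weight, where it is a single sum given by
  the \<open>q\<close>-Vandermonde identity.
\<close>

section \<open>Linear combinations of tangle words\<close>

text \<open>\<open>sphere_eval\<close> is a definite description, so it has a value only if the
  empty link is not itself a combination of sphere relations. The tensor representation settles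
  this: its coefficient at the vacuum vanishes on all relations and is \<open>1\<close> on the empty
  link. \<open>jones_wenzl\<close> is a choice, so existence has to be shown, but its matrix is read
  off from the defining properties. Being killed by the generators leaves one free vector for each
  number of ones in the image; being the unit plus products of generators preserves the pairing with
  these vectors, because that pairing vanishes on every cup. Evaluating the network directly would
  give a sum over the letters of all strands. Schur's lemma allows the scalar to be computed where
  all \<open>m + n\<close> outer letters are \<open>False\<close>. Then only the letters on the
  \<open>k\<close> remaining arcs vary, and by symmetry only the number of ones among them matters,
  which leaves one summation index.\<close>

lemma scale_single [simp]: "scale c (Poly_Mapping.single d e) = Poly_Mapping.single d (c * e)"
  by (simp add: scale_def mult_single)

lemma of_word_Nil [simp]: "of_word [] = 1"
  by (simp add: of_word_def flip: zero_diagram_def)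

lemma of_word_mult: "of_word v * of_word w = of_word (v @ w)"
  by (simp add: of_word_def mult_single plus_diagram_def)

lemma scale_mult_left [simp]: "scale c x * y = scale c (x * y)"
  by (simp add: scale_def mult.assoc)

lemma comb_eq_sum: "x = (\<Sum>d\<in>Poly_Mapping.keys x. scale (Poly_Mapping.lookup x d) (of_word (slices d)))"
proof (rule poly_mapping_eqI)
  fix e
  have "Poly_Mapping.lookup (\<Sum>d\<in>Poly_Mapping.keys x. scale (Poly_Mapping.lookup x d) (of_word (slices d))) e
     = (\<Sum>d\<in>Poly_Mapping.keys x. Poly_Mapping.lookup (scale (Poly_Mapping.lookup x d) (of_word (slices d))) e)"
    by (rule lookup_sum)
  also have "\<dots> = (\<Sum>d\<in>Poly_Mapping.keys x. if d = e then Poly_Mapping.lookup x e else 0)"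
    by (rule sum.cong) (auto simp: lookup_single of_word_def when_def)
  also have "\<dots> = Poly_Mapping.lookup x e"
    by (simp add: in_keys_iff)
  finally show "Poly_Mapping.lookup x e = Poly_Mapping.lookup (\<Sum>d\<in>Poly_Mapping.keys x. scale (Poly_Mapping.lookup x d) (of_word (slices d))) e"
    by simp
qed

lemma comb_induct [case_names zero add]:
  assumes "P 0" and "\<And>c w x. P x \<Longrightarrow> P (scale c (of_word w) + x)"
  shows "P x"
proof -
  have "P (\<Sum>d\<in>D. scale (Poly_Mapping.lookup x d) (of_word (slices d)))" if "finite D" for D
    using that by induction (auto intro: assms)
  from this[OF finite_keys, of x] show ?thesis
    by (simp flip: comb_eq_sum)
qed

lemma keys_scale: "Poly_Mapping.keys (scale c x) \<subseteq> Poly_Mapping.keys x"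
  using keys_mult[of "Poly_Mapping.single 0 c" x] by (auto simp: scale_def split: if_splits)

text \<open>\<open>scale\<close> is left multiplication by a multiple of the identity diagram.
  Stacking is not commutative, so that such multiples are central has to be checked on
  words.\<close>

lemma scale_mult_right [simp]: "x * scale c y = scale c (x * y)"
proof (induction x rule: comb_induct)
  case (add d w x)
  have "of_word w * scale c y = scale c (of_word w * y)"
    by (induction y rule: comb_induct)
      (simp_all add: distrib_left comb.scale_right_distrib of_word_def mult_single ac_simps)
  with add show ?case
    by (simp add: distrib_right comb.scale_right_distrib mult.commute)
qed simp

lemma tangle_combs_eq_span:
  "tangle_combs m n = comb.span {of_word w | w. is_tangle_word m w n}" (is "?T = comb.span ?W")
proof
  show "?T \<subseteq> comb.span ?W"
  proof
    fix x assume x: "x \<in> ?T"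
    have "(\<Sum>d\<in>Poly_Mapping.keys x. scale (Poly_Mapping.lookup x d) (of_word (slices d))) \<in> comb.span ?W"
      using x by (intro comb.span_sum comb.span_scale comb.span_base)
        (auto simp: tangle_combs_def is_tangle_def)
    then show "x \<in> comb.span ?W"
      by (simp flip: comb_eq_sum)
  qed
  have "comb.subspace ?T"
    unfolding comb.subspace_def tangle_combs_def
    using keys_add keys_scale by fastforce
  moreover have "?W \<subseteq> ?T"
    by (auto simp: tangle_combs_def is_tangle_def of_word_def split: if_splits)
  ultimately show "comb.span ?W \<subseteq> ?T"
    by (rule comb.span_minimal[rotated])
qed

lemma of_word_in_tangle_combs [simp]: "of_word w \<in> tangle_combs m n \<longleftrightarrow> is_tangle_word m w n"
  by (simp add: tangle_combs_def of_word_def is_tangle_def)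

lemma tangle_combs_add: "x \<in> tangle_combs m n \<Longrightarrow> y \<in> tangle_combs m n \<Longrightarrow> x + y \<in> tangle_combs m n"
  and tangle_combs_diff: "x \<in> tangle_combs m n \<Longrightarrow> y \<in> tangle_combs m n \<Longrightarrow> x - y \<in> tangle_combs m n"
  and tangle_combs_scale: "x \<in> tangle_combs m n \<Longrightarrow> scale c x \<in> tangle_combs m n"
  and tangle_combs_zero: "0 \<in> tangle_combs m n"
  by (simp_all add: tangle_combs_eq_span comb.span_add comb.span_diff comb.span_scale comb.span_zero)

lemma is_tangle_word_append:
  "is_tangle_word m (v @ w) n \<longleftrightarrow> (\<exists>k. is_tangle_word m v k \<and> is_tangle_word k w n)"
proof (induction v arbitrary: m)
  case (Cons s v)
  obtain i g where s: "s = (i, g)" by force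
  show ?case
    unfolding s append_Cons is_tangle_word.simps Cons.IH by blast
qed simp

lemma is_tangle_word_add_right: "is_tangle_word m w n \<Longrightarrow> is_tangle_word (m + b) w (n + b)"
proof (induction w arbitrary: m)
  case (Cons s w)
  obtain i g where s: "s = (i, g)" by force
  from Cons.prems s have "i + bot_ends g \<le> m" "is_tangle_word (m - bot_ends g + top_ends g) w n"
    by auto
  moreover from this(1) have "m + b - bot_ends g + top_ends g = m - bot_ends g + top_ends g + b"
    by simp
  ultimately show ?case
    unfolding s is_tangle_word.simps by (simp only: Cons.IH) simp
qed simp

lemma is_tangle_word_shift:
  "is_tangle_word m w n \<Longrightarrow> is_tangle_word (a + m) (map (\<lambda>(i, g). (a + i, g)) w) (a + n)"
proof (induction w arbitrary: m)
  case (Cons s w)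
  obtain i g where s: "s = (i, g)" by force
  from Cons.prems s have "i + bot_ends g \<le> m" "is_tangle_word (m - bot_ends g + top_ends g) w n"
    by auto
  moreover from this(1) have "a + m - bot_ends g + top_ends g = a + (m - bot_ends g + top_ends g)"
    by simp
  ultimately show ?case
    unfolding s list.map prod.case is_tangle_word.simps by (simp only: Cons.IH) simp
qed simp

lemma tangle_combs_mult:
  assumes "x \<in> tangle_combs m k" "y \<in> tangle_combs k n"
  shows "x * y \<in> tangle_combs m n"
proof -
  have word: "of_word w * y \<in> tangle_combs m n" if w: "is_tangle_word m w k" for w
    using assms(2) unfolding tangle_combs_eq_span[of k n]
  proof (induction y rule: comb.span_induct_alt)
    case (step c y z)
    then show ?case using w
      by (auto simp: distrib_left of_word_mult is_tangle_word_append
          intro!: tangle_combs_add tangle_combs_scale)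
  qed (simp add: tangle_combs_zero)
  show ?thesis
    using assms(1) unfolding tangle_combs_eq_span[of m k]
  proof (induction x rule: comb.span_induct_alt)
    case (step c x z)
    then show ?case using word
      by (auto simp: distrib_right intro!: tangle_combs_add tangle_combs_scale)
  qed (simp add: tangle_combs_zero)
qed

lemma tangle_combs_one: "1 \<in> tangle_combs n n"
  using of_word_in_tangle_combs[of "[]" n n] by simp

lemma shift_of_word: "shift a (of_word w) = of_word (map (\<lambda>(i, g). (a + i, g)) w)"
  by (simp add: shift_def of_word_def shift_diagram_def)

lemma shift_one [simp]: "shift a 1 = (1::comb)"
  using shift_of_word[of a "[]"] by simp

lemma shift_zero [simp]: "shift a 0 = 0"
  by (simp add: shift_def)

lemma shift_add: "shift a (x + y) = shift a x + shift a y"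
  unfolding shift_def by (rule setsum_keys_plus_distrib) (simp_all add: single_add)

lemma shift_scale: "shift a (scale c x) = scale c (shift a x)"
proof (induction x rule: comb_induct)
  case (add d w x)
  have "shift a (scale e (of_word w)) = scale e (shift a (of_word w))" for e
    by (simp add: shift_def of_word_def)
  with add show ?case
    by (simp add: shift_add comb.scale_right_distrib)
qed simp

lemma shift_diff: "shift a (x - y) = shift a x - shift a y"
  using shift_add[of a "x - y" y] by (simp add: algebra_simps)

lemma shift_mult: "shift a (x * y) = shift a x * shift a y"
proof (induction x rule: comb_induct)
  case (add d w x)
  have "shift a (of_word w * y) = shift a (of_word w) * shift a y"
    by (induction y rule: comb_induct)
      (simp_all add: distrib_left shift_add shift_scale of_word_mult shift_of_word)
  with add show ?case
    by (simp add: distrib_right shift_add shift_scale)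
qed simp

lemma shift_shift: "shift a (shift b x) = shift (a + b) x"
  by (induction x rule: comb_induct)
    (simp_all add: shift_add shift_scale shift_of_word comp_def case_prod_unfold add.assoc)

lemma shift_in_tangle_combs:
  "x \<in> tangle_combs m n \<Longrightarrow> shift a x \<in> tangle_combs (a + m) (a + n)"
  unfolding tangle_combs_eq_span[of m n]
proof (induction x rule: comb.span_induct_alt)
  case (step c x z)
  then show ?case
    by (auto simp: shift_add shift_scale shift_of_word intro!: tangle_combs_add tangle_combs_scale
        is_tangle_word_shift)
qed (simp add: tangle_combs_zero)

lemma tangle_combs_add_right:
  "x \<in> tangle_combs m n \<Longrightarrow> x \<in> tangle_combs (m + b) (n + b)"
  unfolding tangle_combs_eq_span
  by (rule subsetD[OF comb.span_mono, rotated]) (auto intro: is_tangle_word_add_right)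


section \<open>Skein equivalence\<close>

lemma skein_eq_refl [simp]: "skein_eq m n x x"
  by (simp add: skein_eq_def disk_relations_def comb.span_zero)

lemma skein_eq_sym: "skein_eq m n x y \<Longrightarrow> skein_eq m n y x"
  using comb.span_neg[of "x - y"] unfolding skein_eq_def disk_relations_def by simp

lemma skein_eq_trans [trans]: "skein_eq m n x y \<Longrightarrow> skein_eq m n y z \<Longrightarrow> skein_eq m n x z"
  using comb.span_add[of "x - y" _ "y - z"] unfolding skein_eq_def disk_relations_def by simp

lemma skein_eq_add: "skein_eq m n x y \<Longrightarrow> skein_eq m n x' y' \<Longrightarrow> skein_eq m n (x + x') (y + y')"
  unfolding skein_eq_def disk_relations_def add_diff_add by (rule comb.span_add)

lemma skein_eq_scale: "skein_eq m n x y \<Longrightarrow> skein_eq m n (scale c x) (scale c y)"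
  unfolding skein_eq_def disk_relations_def
  by (simp add: comb.span_scale flip: comb.scale_right_diff_distrib)

lemma skein_eq_diff: "skein_eq m n x y \<Longrightarrow> skein_eq m n x' y' \<Longrightarrow> skein_eq m n (x - x') (y - y')"
  using skein_eq_add[of m n x y "scale (-1) x'" "scale (-1) y'"] skein_eq_scale[of m n x' y' "-1"]
  by simp

text \<open>The generators of \<open>disk_relations\<close> carry arbitrary words below and above
  the local relation, so a further factor is absorbed into the outer word.\<close>

lemma skein_eq_mult_right:
  assumes "skein_eq m k x y" "z \<in> tangle_combs k n"
  shows "skein_eq m n (x * z) (y * z)"
proof -
  let ?R = "disk_relations m n"
  have "r * of_word v \<in> ?R" if "r \<in> disk_relations m k" "is_tangle_word k v n" for r v
    using that(1) unfolding disk_relations_def[of m k]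
  proof (induction r rule: comb.span_induct_alt)
    case (step c x y)
    then obtain u r w a b p q where x: "x = of_word u * shift a r * of_word w"
      and *: "local_relation p q r" "is_tangle_word m u (a + p + b)" "is_tangle_word (a + q + b) w k"
      by blast
    have "x * of_word v = of_word u * shift a r * of_word (w @ v)"
      by (simp add: x mult.assoc of_word_mult)
    moreover have "is_tangle_word (a + q + b) (w @ v) n"
      using * that(2) by (auto simp: is_tangle_word_append)
    ultimately have "x * of_word v \<in> ?R"
      using * unfolding disk_relations_def by (intro comb.span_base) blast
    then show ?case using step(2) unfolding disk_relations_def
      by (simp add: distrib_right comb.span_add comb.span_scale)
  qed (simp add: disk_relations_def comb.span_zero)
  note word = this
  have "r * z \<in> ?R" if "r \<in> disk_relations m k" for r
    using assms(2) unfolding tangle_combs_eq_span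
  proof (induction z rule: comb.span_induct_alt)
    case (step c x y)
    then show ?case using word[OF that] unfolding disk_relations_def
      by (auto simp: distrib_left intro!: comb.span_add comb.span_scale)
  qed (simp add: disk_relations_def comb.span_zero)
  with assms show ?thesis
    by (simp add: skein_eq_def flip: left_diff_distrib)
qed

lemma skein_eq_mult_left:
  assumes "skein_eq k n x y" "z \<in> tangle_combs m k"
  shows "skein_eq m n (z * x) (z * y)"
proof -
  let ?R = "disk_relations m n"
  have "of_word v * r \<in> ?R" if "r \<in> disk_relations k n" "is_tangle_word m v k" for r v
    using that(1) unfolding disk_relations_def[of k n]
  proof (induction r rule: comb.span_induct_alt)
    case (step c x y)
    then obtain u r w a b p q where x: "x = of_word u * shift a r * of_word w"
      and *: "local_relation p q r" "is_tangle_word k u (a + p + b)" "is_tangle_word (a + q + b) w n"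
      by blast
    have "of_word v * x = of_word (v @ u) * shift a r * of_word w"
      by (simp add: x flip: mult.assoc of_word_mult)
    moreover have "is_tangle_word m (v @ u) (a + p + b)"
      using * that(2) by (auto simp: is_tangle_word_append)
    ultimately have "of_word v * x \<in> ?R"
      using * unfolding disk_relations_def by (intro comb.span_base) blast
    then show ?case using step(2) unfolding disk_relations_def
      by (simp add: distrib_left comb.span_add comb.span_scale)
  qed (simp add: disk_relations_def comb.span_zero)
  note word = this
  have "z * r \<in> ?R" if "r \<in> disk_relations k n" for r
    using assms(2) unfolding tangle_combs_eq_span
  proof (induction z rule: comb.span_induct_alt)
    case (step c x y)
    then show ?case using word[OF that] unfolding disk_relations_def
      by (auto simp: distrib_right intro!: comb.span_add comb.span_scale)
  qed (simp add: disk_relations_def comb.span_zero)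
  with assms show ?thesis
    by (simp add: skein_eq_def flip: right_diff_distrib)
qed

lemma skein_eq_local:
  assumes "local_relation p q r" "is_tangle_word m u (a + p + b)" "is_tangle_word (a + q + b) w n"
  shows "of_word u * shift a r * of_word w \<in> disk_relations m n"
  unfolding disk_relations_def using assms by (intro comb.span_base) blast

lemma skein_eq_isotopy:
  assumes "isotopy_move p q v v'" "is_tangle_word m u (a + p + b)" "is_tangle_word (a + q + b) w n"
  shows "skein_eq m n (of_word (u @ map (\<lambda>(i, g). (a + i, g)) v @ w))
                      (of_word (u @ map (\<lambda>(i, g). (a + i, g)) v' @ w))"
  using skein_eq_local[OF local_relation.isotopy[OF assms(1)] assms(2,3)]
  by (simp add: skein_eq_def shift_diff shift_of_word of_word_mult algebra_simps)

lemma skein_eq_exchange: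
  assumes "is_tangle_word m u (a + (bot_ends g + c + bot_ends h) + b)"
    and "is_tangle_word (a + (top_ends g + c + top_ends h) + b) w n"
  shows "skein_eq m n (of_word (u @ (a, g) # (a + top_ends g + c, h) # w))
                      (of_word (u @ (a + bot_ends g + c, h) # (a, g) # w))"
  using skein_eq_isotopy[OF exchange assms] by (simp add: add.assoc)

lemma skein_eq_straighten_left:
  assumes "is_tangle_word m u (a + 1 + b)" "is_tangle_word (a + 1 + b) w n"
  shows "skein_eq m n (of_word (u @ (a, Cup) # (Suc a, Cap) # w)) (of_word (u @ w))"
  using skein_eq_isotopy[OF straighten_left assms] by simp

lemma skein_eq_straighten_right:
  assumes "is_tangle_word m u (a + 1 + b)" "is_tangle_word (a + 1 + b) w n"
  shows "skein_eq m n (of_word (u @ (Suc a, Cup) # (a, Cap) # w)) (of_word (u @ w))"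
  using skein_eq_isotopy[OF straighten_right assms] by simp

lemma skein_eq_circle:
  assumes "is_tangle_word m u (a + b)" "is_tangle_word (a + b) w n"
  shows "skein_eq m n (of_word (u @ (a, Cup) # (a, Cap) # w)) (scale loop_value (of_word (u @ w)))"
proof -
  have "of_word u * shift a (of_word [(0, Cup), (0, Cap)] - scale loop_value (of_word [])) * of_word w
      \<in> disk_relations m n"
    using assms by (intro skein_eq_local[OF local_relation.circle]) simp_all
  then show ?thesis
    by (simp add: skein_eq_def shift_diff shift_scale shift_of_word of_word_mult
        left_diff_distrib right_diff_distrib)
qed

section \<open>A representation of tangles on tensor powers of a plane\<close>

lemma Avar_power: "Avar ^ n = Fract (monom 1 n) 1"
proof (induction n)
  case (Suc n)
  have "monom 1 (Suc n) = [:0, 1:] * (monom 1 n :: rat poly)"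
    by (simp add: monom_Suc)
  then show ?case using Suc by (simp add: Avar_def)
qed (simp add: One_fract_def)

lemma Avar_nonzero [simp]: "Avar \<noteq> 0"
  by (simp add: Avar_def Zero_fract_def eq_fract)

lemma Avar_power_eq_1_iff: "Avar ^ n = 1 \<longleftrightarrow> n = 0"
proof
  assume "Avar ^ n = 1"
  then have "monom 1 n = (1 :: rat poly)"
    by (simp add: Avar_power One_fract_def eq_fract)
  then show "n = 0"
    by (metis degree_1 degree_monom_eq zero_neq_one)
qed simp

type_synonym state = "bool list \<Rightarrow> qA"

text \<open>A state is a vector of the tensor algebra of a plane, given by its coordinates.  The matrix of
  the cup is the inverse of the matrix of the cap, so that strands can be straightened, and the
  trace of their product is the loop value.\<close>

definition cup_op :: "state \<Rightarrow> state" where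
  "cup_op f s = (case s of a # b # t \<Rightarrow> (if a = b then 0 else if a then f t else - (Avar ^ 2) * f t)
                 | _ \<Rightarrow> 0)"

definition cap_op :: "state \<Rightarrow> state" where
  "cap_op f s = f (False # True # s) - inverse (Avar ^ 2) * f (True # False # s)"

fun piece_op :: "piece \<Rightarrow> state \<Rightarrow> state" where
  "piece_op Cup f = cup_op f"
| "piece_op Cap f = cap_op f"
| "piece_op CrossR f = (\<lambda>s. Avar * f s + inverse Avar * cup_op (cap_op f) s)"
| "piece_op CrossL f = (\<lambda>s. Avar * cup_op (cap_op f) s + inverse Avar * f s)"

primrec slice_op :: "nat \<Rightarrow> piece \<Rightarrow> state \<Rightarrow> state" where
  "slice_op 0 g f = piece_op g f"
| "slice_op (Suc i) g f =
     (\<lambda>s. case s of [] \<Rightarrow> 0 | a # t \<Rightarrow> slice_op i g (\<lambda>t. f (a # t)) t)"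

fun word_op :: "slice list \<Rightarrow> state \<Rightarrow> state" where
  "word_op [] f = f"
| "word_op ((i, g) # w) f = word_op w (slice_op i g f)"

definition comb_op :: "comb \<Rightarrow> state \<Rightarrow> state" where
  "comb_op x f s = (\<Sum>d\<in>Poly_Mapping.keys x. Poly_Mapping.lookup x d * word_op (slices d) f s)"

lemma cup_op_simps [simp]:
  "cup_op f [] = 0" "cup_op f [a] = 0"
  "cup_op f (a # b # t) = (if a = b then 0 else if a then f t else - (Avar ^ 2) * f t)"
  by (simp_all add: cup_op_def)

lemma slice_op_Suc_simps [simp]:
  "slice_op (Suc i) g f [] = 0"
  "slice_op (Suc i) g f (a # t) = slice_op i g (\<lambda>t. f (a # t)) t"
  by simp_all

declare slice_op.simps(2) [simp del]

definition linear_op :: "(state \<Rightarrow> state) \<Rightarrow> bool" where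
  "linear_op T \<longleftrightarrow> (\<forall>c f h. T (\<lambda>s. c * f s + h s) = (\<lambda>s. c * T f s + T h s))"

lemma linear_op_compose: "linear_op S \<Longrightarrow> linear_op T \<Longrightarrow> linear_op (\<lambda>f. S (T f))"
  by (simp add: linear_op_def)

lemma linear_op_combination: "linear_op T \<Longrightarrow> T (\<lambda>s. c * f s + h s) = (\<lambda>s. c * T f s + T h s)"
  by (simp add: linear_op_def)

lemma linear_op_zero: "linear_op T \<Longrightarrow> T (\<lambda>s. 0) = (\<lambda>s. 0)"
  using linear_op_combination[of T "-1" "\<lambda>s. 0" "\<lambda>s. 0"] by (simp add: fun_eq_iff)

lemma linear_op_scale: "linear_op T \<Longrightarrow> T (\<lambda>s. c * f s) = (\<lambda>s. c * T f s)"
  using linear_op_combination[of T c f "\<lambda>s. 0"] by (simp add: linear_op_zero)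

lemma linear_op_add: "linear_op T \<Longrightarrow> T (\<lambda>s. f s + h s) = (\<lambda>s. T f s + T h s)"
  using linear_op_combination[of T 1 f h] by simp

lemma linear_op_diff: "linear_op T \<Longrightarrow> T (\<lambda>s. f s - h s) = (\<lambda>s. T f s - T h s)"
  using linear_op_combination[of T "-1" h f] by simp

lemma linear_op_sum:
  assumes "linear_op T"
  shows "T (\<lambda>s. \<Sum>i\<in>I. c i * f i s) = (\<lambda>s. \<Sum>i\<in>I. c i * T (f i) s)"
  by (induction I rule: infinite_finite_induct)
    (simp_all add: linear_op_zero[OF assms] linear_op_combination[OF assms])

lemma linear_op_slice_op: "linear_op (slice_op i g)"
proof (induction i)
  case 0
  show ?case
    by (cases g) (auto simp: linear_op_def fun_eq_iff cup_op_def cap_op_def algebra_simps split: list.splits)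
next
  case (Suc i)
  have "slice_op (Suc i) g (\<lambda>s. c * f s + h s) s = c * slice_op (Suc i) g f s + slice_op (Suc i) g h s"
    for c f h s
    by (cases s) (simp_all add: linear_op_combination[OF Suc])
  then show ?case by (simp add: linear_op_def fun_eq_iff)
qed

lemma linear_op_word_op: "linear_op (word_op w)"
proof (induction w)
  case (Cons s w)
  obtain i g where s: "s = (i, g)" by force
  show ?case
    using linear_op_compose[OF Cons linear_op_slice_op[of i g]] s by simp
qed (simp add: linear_op_def)

lemma word_op_append: "word_op (v @ w) f = word_op w (word_op v f)"
  by (induction v f rule: word_op.induct) simp_all

lemma comb_op_zero [simp]: "comb_op 0 f = (\<lambda>s. 0)"
  by (simp add: comb_op_def fun_eq_iff)

lemma comb_op_of_word [simp]: "comb_op (of_word w) f = word_op w f"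
  by (simp add: comb_op_def fun_eq_iff of_word_def)

lemma comb_op_one [simp]: "comb_op 1 f = f"
  using comb_op_of_word[of "[]"] by simp

lemma comb_op_add [simp]: "comb_op (x + y) f = (\<lambda>s. comb_op x f s + comb_op y f s)"
  unfolding comb_op_def fun_eq_iff
  by (intro allI setsum_keys_plus_distrib) (simp_all add: distrib_right)

lemma comb_op_scale [simp]: "comb_op (scale c x) f = (\<lambda>s. c * comb_op x f s)"
proof (induction x rule: comb_induct)
  case (add d w x)
  have "comb_op (scale e (of_word w)) f = (\<lambda>s. e * word_op w f s)" for e
    by (simp add: comb_op_def fun_eq_iff of_word_def)
  with add show ?case
    by (simp add: comb.scale_right_distrib distrib_left mult.assoc)
qed simp

lemma comb_op_diff [simp]: "comb_op (x - y) f = (\<lambda>s. comb_op x f s - comb_op y f s)"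
  using comb_op_add[of "x - y" y f] by (simp add: fun_eq_iff algebra_simps)

lemma linear_op_comb_op: "linear_op (comb_op x)"
proof (induction x rule: comb_induct)
  case (add c w x)
  then show ?case
    using linear_op_word_op[of w] by (simp add: linear_op_def algebra_simps)
qed (simp add: linear_op_def)

lemma comb_op_mult [simp]: "comb_op (x * y) f = comb_op y (comb_op x f)"
proof (induction x arbitrary: y rule: comb_induct)
  case (add c w x)
  have "comb_op (of_word w * y) f = comb_op y (word_op w f)"
    by (induction y rule: comb_induct)
      (simp_all add: distrib_left of_word_mult word_op_append)
  with add show ?case
    by (simp add: distrib_right linear_op_combination[OF linear_op_comb_op])
qed (simp add: linear_op_zero[OF linear_op_comb_op])

lemma comb_op_shift: "length r = a \<Longrightarrow> comb_op (shift a x) f (r @ s) = comb_op x (\<lambda>t. f (r @ t)) s"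
proof (induction x arbitrary: f rule: comb_induct)
  case (add c w x)
  have slice: "slice_op (a + i) g f (r @ s) = slice_op i g (\<lambda>t. f (r @ t)) s"
    if "length r = a" for a i g f r s
    using that by (induction r arbitrary: f a) auto
  have "word_op (map (\<lambda>(i, g). (a + i, g)) w) f (r @ s) = word_op w (\<lambda>t. f (r @ t)) s" for f
  proof (induction w arbitrary: f)
    case (Cons x w)
    obtain i g where "x = (i, g)" by force
    then show ?case using Cons by (simp add: slice[OF add.prems])
  qed simp
  with add show ?case
    by (simp add: shift_add shift_scale shift_of_word)
qed simp

section \<open>Tensor powers of a fixed length and frozen strands\<close>

definition supported :: "nat \<Rightarrow> state \<Rightarrow> bool" where
  "supported n f \<longleftrightarrow> (\<forall>s. length s \<noteq> n \<longrightarrow> f s = 0)"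

lemma supported_slice_op:
  "supported n f \<Longrightarrow> i + bot_ends g \<le> n \<Longrightarrow> supported (n - bot_ends g + top_ends g) (slice_op i g f)"
proof (induction i arbitrary: n f)
  case 0
  then show ?case
    by (cases g) (auto simp: supported_def cup_op_def cap_op_def split: list.splits)
next
  case (Suc i)
  have "slice_op (Suc i) g f s = 0" if "length s \<noteq> n - bot_ends g + top_ends g" for s
  proof (cases s)
    case (Cons a t)
    have "supported (n - 1) (\<lambda>t. f (a # t))"
      using Suc.prems by (auto simp: supported_def)
    from Suc.IH[OF this] have "supported (n - 1 - bot_ends g + top_ends g) (slice_op i g (\<lambda>t. f (a # t)))"
      using Suc.prems by simp
    moreover have "length t \<noteq> n - 1 - bot_ends g + top_ends g"
      using that Cons Suc.prems(2) by auto
    ultimately show ?thesis using Cons by (simp add: supported_def)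
  qed simp
  then show ?case by (simp add: supported_def)
qed

lemma supported_word_op: "supported m f \<Longrightarrow> is_tangle_word m w n \<Longrightarrow> supported n (word_op w f)"
proof (induction w arbitrary: m f)
  case (Cons s w)
  obtain i g where s: "s = (i, g)" by force
  have "i + bot_ends g \<le> m" "is_tangle_word (m - bot_ends g + top_ends g) w n"
    using Cons.prems(2) unfolding s is_tangle_word.simps by blast+
  then show ?case
    using Cons.IH[OF supported_slice_op[OF Cons.prems(1)]] s by simp
qed simp

lemma supported_comb_op:
  assumes "supported m f" "x \<in> tangle_combs m n"
  shows "supported n (comb_op x f)"
  using assms(2) unfolding tangle_combs_eq_span
proof (induction x rule: comb.span_induct_alt)
  case (step c x y)
  then show ?case
    using supported_word_op[OF assms(1)] by (auto simp: supported_def)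
qed (simp add: supported_def)

text \<open>Freezing the strands \<open>s\<close> to the right of the first \<open>n\<close> ones, on which a tangle with \<open>n\<close>
  bottom end points does not act.\<close>

definition cut :: "nat \<Rightarrow> bool list \<Rightarrow> state \<Rightarrow> state" where
  "cut n s f = (\<lambda>r. if length r = n then f (r @ s) else 0)"

lemma supported_cut [simp]: "supported n (cut n s f)"
  by (simp add: supported_def cut_def)

lemma slice_op_cut:
  "i + bot_ends g \<le> n \<Longrightarrow> length r = n - bot_ends g + top_ends g \<Longrightarrow>
     slice_op i g f (r @ s) = slice_op i g (cut n s f) r"
proof (induction i arbitrary: n r f)
  case 0
  show ?case
  proof (cases g)
    case Cup
    with 0 obtain a b r' where "r = a # b # r'" "length r' = n"
      by (cases r; cases "tl r") auto
    then show ?thesis by (simp add: Cup cut_def)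
  next
    case Cap
    with 0 have "n = Suc (Suc (length r))" by simp
    with Cap show ?thesis by (simp add: cut_def cap_op_def)
  next
    case CrossR
    with 0 obtain a b r' where "r = a # b # r'" "n = Suc (Suc (length r'))"
      by (cases r; cases "tl r") auto
    then show ?thesis by (simp add: CrossR cut_def cap_op_def)
  next
    case CrossL
    with 0 obtain a b r' where "r = a # b # r'" "n = Suc (Suc (length r'))"
      by (cases r; cases "tl r") auto
    then show ?thesis by (simp add: CrossL cut_def cap_op_def)
  qed
next
  case (Suc i)
  then have "r \<noteq> []" by auto
  then obtain a t where r: "r = a # t" by (cases r) auto
  have "cut (n - 1) s (\<lambda>t. f (a # t)) = (\<lambda>t. cut n s f (a # t))"
    using Suc.prems(1) by (auto simp: cut_def fun_eq_iff)
  with Suc.IH[of "n - 1" t "\<lambda>t. f (a # t)"] Suc.prems r show ?case by auto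
qed

lemma word_op_cut:
  "is_tangle_word m w n \<Longrightarrow> length r = n \<Longrightarrow> word_op w f (r @ s) = word_op w (cut m s f) r"
proof (induction w arbitrary: m f)
  case (Cons x w)
  obtain i g where x: "x = (i, g)" by force
  let ?k = "m - bot_ends g + top_ends g"
  have le: "i + bot_ends g \<le> m" and w: "is_tangle_word ?k w n"
    using Cons.prems(1) unfolding x is_tangle_word.simps by blast+
  have "cut ?k s (slice_op i g f) = slice_op i g (cut m s f)"
    using supported_slice_op[OF supported_cut le] slice_op_cut[OF le]
    by (fastforce simp: cut_def supported_def fun_eq_iff)
  then show ?case using Cons.IH[OF w Cons.prems(2)] x by simp
qed (simp add: cut_def)

lemma comb_op_cut:
  assumes "x \<in> tangle_combs m n" "length r = n"
  shows "comb_op x f (r @ s) = comb_op x (cut m s f) r"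
  using assms(1) unfolding tangle_combs_eq_span
proof (induction x rule: comb.span_induct_alt)
  case (step c x y)
  then show ?case
    using word_op_cut[OF _ assms(2)] by auto
qed simp

lemma linear_op_uminus: "linear_op T \<Longrightarrow> T (\<lambda>s. - f s) = (\<lambda>s. - T f s)"
  using linear_op_scale[of T "-1" f] by simp

lemmas slice_op_linear =
  linear_op_slice_op[THEN linear_op_zero] linear_op_slice_op[THEN linear_op_scale]
  linear_op_slice_op[THEN linear_op_add] linear_op_slice_op[THEN linear_op_diff]
  linear_op_slice_op[THEN linear_op_uminus]

section \<open>Invariance under isotopy moves and skein relations\<close>

lemma slice_op_add_2:
  "slice_op (2 + c) g f s =
     (case s of a # b # t \<Rightarrow> slice_op c g (\<lambda>t. f (a # b # t)) t | _ \<Rightarrow> 0)"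
  by (cases s; cases "tl s") (auto simp: numeral_2_eq_2)

text \<open>The left piece involves only the leading letters and forms linear combinations of values
  at the same tail. The right piece is linear and acts on the tail with these letters held
  fixed.\<close>

lemma slice_op_exchange:
  "slice_op (top_ends g + c) h (slice_op 0 g f) s = slice_op 0 g (slice_op (bot_ends g + c) h f) s"
proof -
  consider "s = []" | a where "s = [a]" | a b t where "s = a # b # t"
    by (cases s; cases "tl s") auto
  then show ?thesis
  proof cases
    case 1
    then show ?thesis by (cases g) (simp_all add: cap_op_def[abs_def] slice_op_add_2 slice_op_linear)
  next
    case 2
    then show ?thesis by (cases g) (simp_all add: cap_op_def[abs_def] slice_op_add_2 slice_op_linear)
  next
    case 3
    then show ?thesis by (cases g; cases a; cases b) (simp_all add: cap_op_def[abs_def] slice_op_add_2 slice_op_linear)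
  qed
qed

lemma is_tangle_word_isotopy_move:
  "isotopy_move p q v w \<Longrightarrow> is_tangle_word p v q \<and> is_tangle_word p w q"
  by (induction rule: isotopy_move.induct) auto

text \<open>The support condition matters on short words: on the empty word a straightened strand
  acts by 0, since \<open>slice_op\<close> defaults to 0 there, while the identity keeps the value.
  On words of the right length the moves are finite checks on at most three letters.\<close>

lemma word_op_isotopy_move:
  assumes "isotopy_move p q v w" "supported (p + b) f"
  shows "word_op v f = word_op w f"
proof
  fix s
  show "word_op v f s = word_op w f s"
  proof (cases "length s = q + b")
    case True
    have three: "\<exists>x y z t. s = x # y # z # t" if "length s = 3 + b"
      using that by (cases s; cases "tl s"; cases "tl (tl s)") auto
    have two: "\<exists>x y t. s = x # y # t" if "length s = 2 + b"
      using that by (cases s; cases "tl s") auto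
    have one: "\<exists>x t. s = x # t" if "length s = 1 + b"
      using that by (cases s) auto
    have [simp]: "Avar * inverse Avar = 1" "Avar * (inverse Avar * x) = x" for x
      using right_inverse[OF Avar_nonzero] by (simp_all only: mult.assoc[symmetric] mult_1)
    from assms(1) True show ?thesis
    proof cases
      case (exchange g c h)
      then show ?thesis using slice_op_exchange[of g c h f s] by simp
    next
      case reidemeister3
      then obtain x y z t where "s = x # y # z # t" using True three by auto
      with reidemeister3 show ?thesis
        by (cases x; cases y; cases z; simp add: cap_op_def power2_eq_square algebra_simps)
    next
      case straighten_left
      with True one obtain x t where "s = x # t" by auto
      with straighten_left show ?thesis
        by (cases x; simp add: cap_op_def)
    next
      case straighten_right
      with True one obtain x t where "s = x # t" by auto
      with straighten_right show ?thesis
        by (cases x; simp add: cap_op_def)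
    next
      case reidemeister2_RL
      with True two obtain x y t where "s = x # y # t" by auto
      with reidemeister2_RL show ?thesis
        by (cases x; cases y; simp add: cap_op_def power2_eq_square algebra_simps)
    next
      case reidemeister2_LR
      with True two obtain x y t where "s = x # y # t" by auto
      with reidemeister2_LR show ?thesis
        by (cases x; cases y; simp add: cap_op_def power2_eq_square algebra_simps)
    next
      case slide_cap_R
      with True one obtain x t where "s = x # t" by auto
      with slide_cap_R show ?thesis
        by (cases x; simp add: cap_op_def power2_eq_square algebra_simps)
    next
      case slide_cap_L
      with True one obtain x t where "s = x # t" by auto
      with slide_cap_L show ?thesis
        by (cases x; simp add: cap_op_def power2_eq_square algebra_simps)
    next
      case slide_cup_R
      with True three obtain x y z t where "s = x # y # z # t" by auto
      with slide_cup_R show ?thesis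
        by (cases x; cases y; cases z; simp add: cap_op_def power2_eq_square algebra_simps)
    next
      case slide_cup_L
      with True three obtain x y z t where "s = x # y # z # t" by auto
      with slide_cup_L show ?thesis
        by (cases x; cases y; cases z; simp add: cap_op_def power2_eq_square algebra_simps)
    next
      case kink_R
      with True one obtain x t where "s = x # t" by auto
      with kink_R show ?thesis
        by (cases x; simp add: cap_op_def power2_eq_square algebra_simps)
    next
      case kink_L
      with True one obtain x t where "s = x # t" by auto
      with kink_L show ?thesis
        by (cases x; simp add: cap_op_def power2_eq_square algebra_simps)
    qed
  next
    case False
    have "supported (q + b) (word_op v f)" "supported (q + b) (word_op w f)"
      using is_tangle_word_isotopy_move[OF assms(1)]
      by (auto intro!: supported_word_op[OF assms(2)] is_tangle_word_add_right)
    with False show ?thesis by (simp add: supported_def)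
  qed
qed


lemma loop_value_eq: "loop_value = - (Avar ^ 2) - inverse (Avar ^ 2)"
  by (simp add: loop_value_def power_int_minus)

lemma local_relation_in_tangle_combs: "local_relation p q r \<Longrightarrow> r \<in> tangle_combs p q"
proof (induction rule: local_relation.induct)
  case (isotopy p q v w)
  then show ?case
    using is_tangle_word_isotopy_move by (auto intro!: tangle_combs_diff)
qed (auto intro!: tangle_combs_diff tangle_combs_add tangle_combs_scale tangle_combs_one)

lemma comb_op_local_relation:
  assumes "local_relation p q r" "supported (p + b) f"
  shows "comb_op r f = (\<lambda>s. 0)"
  using assms
proof (cases rule: local_relation.cases)
  case (isotopy v w)
  then show ?thesis
    using word_op_isotopy_move[OF _ assms(2)] by simp
next
  case circle
  then show ?thesis
    by (simp add: fun_eq_iff cap_op_def loop_value_eq algebra_simps)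
qed (simp_all add: fun_eq_iff)

lemma comb_op_disk_relations:
  assumes "x \<in> disk_relations m n" "supported m f"
  shows "comb_op x f = (\<lambda>s. 0)"
  using assms(1) unfolding disk_relations_def
proof (induction x rule: comb.span_induct_alt)
  case (step c x y)
  then obtain u r w a b p q where x: "x = of_word u * shift a r * of_word w"
    and r: "local_relation p q r" and u: "is_tangle_word m u (a + p + b)"
    and w: "is_tangle_word (a + q + b) w n"
    by blast
  define h where "h = word_op u f"
  have h: "supported (a + p + b) h"
    unfolding h_def by (rule supported_word_op[OF assms(2) u])
  have "comb_op (shift a r) h = (\<lambda>s. 0)"
  proof
    fix s
    have "shift a r \<in> tangle_combs (a + p + b) (a + q + b)"
      by (intro tangle_combs_add_right shift_in_tangle_combs local_relation_in_tangle_combs r)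
    from supported_comb_op[OF h this] have supp: "supported (a + q + b) (comb_op (shift a r) h)" .
    show "comb_op (shift a r) h s = 0"
    proof (cases "length s = a + q + b")
      case True
      \<comment> \<open>Fixing the letters of the \<open>a\<close> strands on the left leaves a
        state on \<open>p + b\<close> strands, where the \<open>b\<close> strands on the right are
        inert.\<close>
      have "supported (p + b) (\<lambda>t. h (take a s @ t))"
        using h True by (auto simp: supported_def)
      from comb_op_local_relation[OF r this] True
      show ?thesis
        using comb_op_shift[of "take a s" a r h "drop a s"] by simp
    qed (use supp in \<open>simp add: supported_def\<close>)
  qed
  then have "comb_op x f = (\<lambda>s. 0)"
    using linear_op_zero[OF linear_op_word_op] by (simp add: x h_def)
  then show ?case using step by simp
qed simp

lemma comb_op_skein_eq: "skein_eq m n x y \<Longrightarrow> supported m f \<Longrightarrow> comb_op x f = comb_op y f"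
  using comb_op_disk_relations[of "x - y" m n f] by (simp add: skein_eq_def fun_eq_iff)

text \<open>The action of the raising generator of quantum \<open>sl\<^sub>2\<close> for the coproduct
  \<open>E \<otimes> 1 + K \<otimes> E\<close>.\<close>

fun raise_op :: "state \<Rightarrow> state" where
  "raise_op f [] = 0"
| "raise_op f (True # s) = f (False # s) + Avar ^ 2 * raise_op (\<lambda>t. f (True # t)) s"
| "raise_op f (False # s) = inverse (Avar ^ 2) * raise_op (\<lambda>t. f (False # t)) s"

lemma linear_op_raise_op: "linear_op raise_op"
proof -
  have "raise_op (\<lambda>s. c * f s + h s) s = c * raise_op f s + raise_op h s" for c f h s
  proof (induction s arbitrary: f h)
    case (Cons a s)
    then show ?case by (cases a) (simp_all add: algebra_simps)
  qed simp
  then show ?thesis by (simp add: linear_op_def fun_eq_iff)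
qed

lemmas raise_op_linear =
  linear_op_raise_op[THEN linear_op_zero] linear_op_raise_op[THEN linear_op_scale]
  linear_op_raise_op[THEN linear_op_add] linear_op_raise_op[THEN linear_op_diff]
  linear_op_raise_op[THEN linear_op_uminus]

text \<open>The vector inserted by a cup is invariant: at \<open>True # True\<close> the
  contributions \<open>- (Avar ^ 2)\<close> and \<open>Avar ^ 2\<close> cancel, and its two letters
  are opposite, so passing them costs \<open>Avar ^ 2 * inverse (Avar ^ 2) = 1\<close>.\<close>

lemma raise_op_cup_op: "raise_op (cup_op f) = cup_op (raise_op f)"
proof
  fix s :: "bool list"
  consider "s = []" | a where "s = [a]" | a b t where "s = a # b # t"
    by (cases s; cases "tl s") auto
  then show "raise_op (cup_op f) s = cup_op (raise_op f) s"
  proof cases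
    case 2
    then show ?thesis by (cases a) (simp_all add: raise_op_linear)
  next
    case 3
    then show ?thesis by (cases a; cases b; simp add: raise_op_linear; simp add: field_simps)
  qed simp
qed

lemma raise_op_cap_op: "raise_op (cap_op f) = cap_op (raise_op f)"
  by (rule ext, simp add: cap_op_def[abs_def] raise_op_linear) (simp add: field_simps)

text \<open>Crossings act by combinations of the identity and a cap followed by a cup, so the cup
  and the cap are the only pieces to check. A fixed letter on the left contributes only scalars and
  one shifted copy.\<close>

lemma raise_op_slice_op: "raise_op (slice_op i g f) = slice_op i g (raise_op f)"
proof
  fix s
  show "raise_op (slice_op i g f) s = slice_op i g (raise_op f) s"
  proof (induction i arbitrary: f s)
    case 0
    have "raise_op (cup_op (cap_op f)) = cup_op (cap_op (raise_op f))" for f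
      by (simp add: raise_op_cup_op raise_op_cap_op)
    then show ?case
      by (cases g) (simp_all add: raise_op_linear raise_op_cup_op raise_op_cap_op)
  next
    case (Suc i)
    show ?case
    proof (cases s)
      case (Cons a t)
      then show ?thesis
        by (cases a) (simp_all add: Suc slice_op_linear)
    qed simp
  qed
qed

lemma raise_op_word_op: "raise_op (word_op w f) = word_op w (raise_op f)"
  by (induction w f rule: word_op.induct) (simp_all add: raise_op_slice_op)

lemma raise_op_comb_op: "raise_op (comb_op x f) = comb_op x (raise_op f)"
  by (induction x rule: comb_induct)
    (simp_all add: raise_op_linear raise_op_word_op)

definition vacuum :: state where
  "vacuum s = (if s = [] then 1 else 0)"

lemma supported_vacuum [simp]: "supported 0 vacuum"
  by (simp add: supported_def vacuum_def)

text \<open>The right closure weighs the diagonal entries at \<open>False\<close> and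
  \<open>True\<close> by \<open>- (Avar ^ 2)\<close> and \<open>- inverse (Avar ^ 2)\<close>; the
  left closure uses the same weights in exchanged order. The closures agree because the two entries
  are equal.\<close>

lemma comb_op_sphere_relations:
  assumes "x \<in> sphere_relations"
  shows "comb_op x vacuum [] = 0"
  using assms unfolding sphere_relations_def
proof (induction x rule: comb.span_induct_alt)
  case (step c x y)
  have "comb_op x vacuum [] = 0"
  proof (cases "x \<in> disk_relations 0 0")
    case True
    then show ?thesis by (simp add: comb_op_disk_relations)
  next
    case False
    with step(1) obtain d where d: "is_tangle 1 d 1"
      and x: "x = of_word ([(0, Cup)] @ slices d @ [(0, Cap)])
                - of_word ([(0, Cup)] @ slices (shift_diagram 1 d) @ [(0, Cap)])"
      by blast
    define T where "T = word_op (slices d)"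
    define unit where "unit a = (\<lambda>s. if s = [a] then 1 else 0 :: qA)" for a :: bool
    have lin: "linear_op T"
      by (simp add: T_def linear_op_word_op)
    have "raise_op vacuum s = 0" for s
    proof (cases s)
      case (Cons a t)
      then show ?thesis by (cases a) (simp_all add: vacuum_def raise_op_linear)
    qed simp
    then have vac: "raise_op vacuum = (\<lambda>s. 0)" by blast
    have "raise_op (unit False) s = unit True s" for s
    proof (cases s)
      case (Cons a t)
      have "(\<lambda>t. unit False (False # t)) = vacuum"
        by (simp add: unit_def vacuum_def fun_eq_iff)
      then show ?thesis using Cons vac
        by (cases a) (simp_all add: unit_def raise_op_linear)
    qed (simp add: unit_def)
    then have unit: "raise_op (unit False) = unit True" by blast
    \<comment> \<open>\<open>unit True\<close> is the raised \<open>unit False\<close>. Moving the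
      raising operator past the tangle and evaluating at \<open>[True]\<close> leaves the entry at
      \<open>[False]\<close>.\<close>
    have diag: "T (unit True) [True] = T (unit False) [False]"
      by (simp add: T_def flip: unit raise_op_word_op)
    have right: "T (cup_op vacuum) [a, b] = (if b then - (Avar ^ 2) * T (unit False) [a] else T (unit True) [a])"
      for a b
    proof -
      have "cut 1 [b] (cup_op vacuum) = (\<lambda>s. (if b then - (Avar ^ 2) else 1) * unit (\<not> b) s)"
      proof
        fix s
        show "cut 1 [b] (cup_op vacuum) s = (if b then - (Avar ^ 2) else 1) * unit (\<not> b) s"
        proof (cases "length s = 1")
          case True
          then obtain c where "s = [c]" by (auto simp: length_Suc_conv)
          then show ?thesis by (cases c; cases b) (simp_all add: cut_def unit_def vacuum_def)
        qed (auto simp: cut_def unit_def)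
      qed
      then show ?thesis
        using word_op_cut[of 1 "slices d" 1 "[a]" "cup_op vacuum" "[b]"] d
        by (simp add: is_tangle_def T_def[symmetric] linear_op_scale[OF lin] linear_op_uminus[OF lin])
    qed
    have left: "word_op (slices (shift_diagram 1 d)) (cup_op vacuum) [a, b] =
        (if a then T (unit False) [b] else - (Avar ^ 2) * T (unit True) [b])" for a b
    proof -
      have "(\<lambda>t. cup_op vacuum ([a] @ t)) = (\<lambda>s. (if a then 1 else - (Avar ^ 2)) * unit (\<not> a) s)"
      proof
        fix s
        show "cup_op vacuum ([a] @ s) = (if a then 1 else - (Avar ^ 2)) * unit (\<not> a) s"
          by (cases s; cases a) (auto simp: unit_def vacuum_def)
      qed
      then show ?thesis
        using comb_op_shift[of "[a]" 1 "of_word (slices d)" "cup_op vacuum" "[b]"]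
        by (simp add: shift_of_word shift_diagram_def T_def[symmetric] linear_op_scale[OF lin]
            linear_op_uminus[OF lin])
    qed
    show ?thesis
      using right left diag
      by (simp add: x word_op_append cap_op_def flip: T_def)
  qed
  then show ?case using step by simp
qed simp

section \<open>Reduction of closed diagrams\<close>

definition cup_words :: "nat \<Rightarrow> comb set" where
  "cup_words n = {of_word v | v. (\<forall>s\<in>set v. snd s = Cup) \<and> is_tangle_word 0 v n}"

text \<open>Compare the cap with the topmost cup. If they share an end, both disappear into a circle
  or a straight strand. Otherwise an exchange puts the cap below that cup, where the shorter word is
  treated by induction and the cup is put back on top.\<close>

lemma cup_word_Cap:
  assumes "\<forall>s\<in>set v. snd s = Cup" "is_tangle_word 0 v n" "j + 2 \<le> n"
  shows "\<exists>c v'. (\<forall>s\<in>set v'. snd s = Cup) \<and> is_tangle_word 0 v' (n - 2)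
           \<and> skein_eq 0 (n - 2) (of_word (v @ [(j, Cap)])) (scale c (of_word v'))"
  using assms
proof (induction v arbitrary: n j rule: rev_induct)
  case (snoc s v)
  obtain i k where s: "s = (i, Cup)" and v: "is_tangle_word 0 v k" and i: "i \<le> k" and n: "n = k + 2"
    using snoc.prems by (cases s) (auto simp: is_tangle_word_append)
  have cups: "\<forall>s\<in>set v. snd s = Cup" and j: "j \<le> k" and n2: "n - 2 = k"
    using snoc.prems n by auto
  \<comment> \<open>The cases are a circle, the two straightenings, and a cap lying wholly to the
    right or to the left of the ends of the cup.\<close>
  consider "j = i" | "j = Suc i" | "i = Suc j" | c where "j = i + 2 + c" | c where "i = j + 2 + c"
    using less_linear[of i j] by (metis Suc_lessI add_2_eq_Suc' less_iff_Suc_add add.commute add_Suc_right)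
  then show ?case
  proof cases
    case 1
    then have "skein_eq 0 k (of_word (v @ (i, Cup) # (j, Cap) # [])) (scale loop_value (of_word (v @ [])))"
      using skein_eq_circle[of 0 v i "k - i" "[]" k] v i by simp
    then show ?thesis using cups v n2 s
      by (intro exI[of _ loop_value] exI[of _ v]) simp
  next
    case 2
    then have "skein_eq 0 k (of_word (v @ (i, Cup) # (j, Cap) # [])) (scale 1 (of_word (v @ [])))"
      using skein_eq_straighten_left[of 0 v i "k - Suc i" "[]" k] v j by simp
    then show ?thesis using cups v n2 s
      by (intro exI[of _ 1] exI[of _ v]) simp
  next
    case 3
    then have "skein_eq 0 k (of_word (v @ (i, Cup) # (j, Cap) # [])) (scale 1 (of_word (v @ [])))"
      using skein_eq_straighten_right[of 0 v j "k - Suc j" "[]" k] v i by simp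
    then show ?thesis using cups v n2 s
      by (intro exI[of _ 1] exI[of _ v]) simp
  next
    case 4
    have exch: "skein_eq 0 k (of_word (v @ [(i, Cup), (j, Cap)])) (of_word (v @ [(i + c, Cap), (i, Cup)]))"
      using skein_eq_exchange[of 0 v i Cup c Cap "k - j" "[]" k] v j 4 by simp
    obtain d v' where v': "\<forall>s\<in>set v'. snd s = Cup" "is_tangle_word 0 v' (k - 2)"
      "skein_eq 0 (k - 2) (of_word (v @ [(i + c, Cap)])) (scale d (of_word v'))"
      using snoc.IH[OF cups v, of "i + c"] j 4 by auto
    have "skein_eq 0 k (of_word (v @ [(i + c, Cap)]) * of_word [(i, Cup)])
        (scale d (of_word v') * of_word [(i, Cup)])"
      using v'(3) by (rule skein_eq_mult_right) (use j 4 in auto)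
    then have "skein_eq 0 k (of_word (v @ [(i, Cup), (j, Cap)])) (scale d (of_word (v' @ [(i, Cup)])))"
      using exch by (auto intro: skein_eq_trans simp: of_word_mult)
    moreover have "is_tangle_word 0 (v' @ [(i, Cup)]) k"
      using v'(2) j 4 by (auto simp: is_tangle_word_append)
    ultimately show ?thesis using v'(1) n2 s
      by (intro exI[of _ d] exI[of _ "v' @ [(i, Cup)]"]) auto
  next
    case 5
    have exch: "skein_eq 0 k (of_word (v @ [(i, Cup), (j, Cap)])) (of_word (v @ [(j, Cap), (j + c, Cup)]))"
      using skein_eq_exchange[of 0 v j Cap c Cup "k - i" "[]" k] v i 5
      by (auto intro: skein_eq_sym)
    obtain d v' where v': "\<forall>s\<in>set v'. snd s = Cup" "is_tangle_word 0 v' (k - 2)"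
      "skein_eq 0 (k - 2) (of_word (v @ [(j, Cap)])) (scale d (of_word v'))"
      using snoc.IH[OF cups v, of j] i 5 by auto
    have "skein_eq 0 k (of_word (v @ [(j, Cap)]) * of_word [(j + c, Cup)])
        (scale d (of_word v') * of_word [(j + c, Cup)])"
      using v'(3) by (rule skein_eq_mult_right) (use i 5 in auto)
    then have "skein_eq 0 k (of_word (v @ [(i, Cup), (j, Cap)])) (scale d (of_word (v' @ [(j + c, Cup)])))"
      using exch by (auto intro: skein_eq_trans simp: of_word_mult)
    moreover have "is_tangle_word 0 (v' @ [(j + c, Cup)]) k"
      using v'(2) i 5 by (auto simp: is_tangle_word_append)
    ultimately show ?thesis using v'(1) n2 s
      by (intro exI[of _ d] exI[of _ "v' @ [(j + c, Cup)]"]) auto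
  qed
qed simp

text \<open>Building up a closed word passes through initial parts with open ends at the top. The
  reduction is therefore stated for every number \<open>n\<close> of ends, with \<open>n = 0\<close>
  as the goal.\<close>

definition cup_reducible :: "nat \<Rightarrow> comb set" where
  "cup_reducible n = {x. \<exists>y\<in>comb.span (cup_words n). skein_eq 0 n x y}"

lemma cup_reducible_add: "x \<in> cup_reducible n \<Longrightarrow> y \<in> cup_reducible n \<Longrightarrow> x + y \<in> cup_reducible n"
  unfolding cup_reducible_def by (blast intro: comb.span_add skein_eq_add)

lemma cup_reducible_scale: "x \<in> cup_reducible n \<Longrightarrow> scale c x \<in> cup_reducible n"
  unfolding cup_reducible_def by (blast intro: comb.span_scale skein_eq_scale)

lemma cup_reducible_zero: "0 \<in> cup_reducible n"
  unfolding cup_reducible_def using comb.span_zero skein_eq_refl by blast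

lemma cup_reducible_skein_eq: "skein_eq 0 n x y \<Longrightarrow> y \<in> cup_reducible n \<Longrightarrow> x \<in> cup_reducible n"
  unfolding cup_reducible_def by (blast intro: skein_eq_trans)

lemma cup_reducible_cup_words: "x \<in> cup_words n \<Longrightarrow> x \<in> cup_reducible n"
  unfolding cup_reducible_def by (blast intro: comb.span_base skein_eq_refl)

lemma cup_reducible_mult:
  assumes "x \<in> cup_reducible k" and word: "\<And>v. v \<in> cup_words k \<Longrightarrow> v * z \<in> cup_reducible n"
    and z: "z \<in> tangle_combs k n"
  shows "x * z \<in> cup_reducible n"
proof -
  obtain y where y: "y \<in> comb.span (cup_words k)" "skein_eq 0 k x y"
    using assms(1) by (auto simp: cup_reducible_def)
  from y(1) have "y * z \<in> cup_reducible n"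
    by (induction y rule: comb.span_induct_alt)
      (simp_all add: distrib_right word cup_reducible_zero cup_reducible_add cup_reducible_scale)
  then show ?thesis
    by (rule cup_reducible_skein_eq[OF skein_eq_mult_right[OF y(2) z]])
qed

lemma cup_reducible_Cup: "x \<in> cup_reducible k \<Longrightarrow> i \<le> k \<Longrightarrow> x * of_word [(i, Cup)] \<in> cup_reducible (k + 2)"
  by (rule cup_reducible_mult[of _ k])
    (fastforce simp: cup_words_def of_word_mult is_tangle_word_append intro!: cup_reducible_cup_words)+

lemma cup_reducible_Cap:
  assumes "x \<in> cup_reducible k" "i + 2 \<le> k"
  shows "x * of_word [(i, Cap)] \<in> cup_reducible (k - 2)"
  using assms(1)
proof (rule cup_reducible_mult)
  fix v assume "v \<in> cup_words k"
  then obtain w where w: "v = of_word w" "\<forall>s\<in>set w. snd s = Cup" "is_tangle_word 0 w k"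
    by (auto simp: cup_words_def)
  with cup_word_Cap[OF w(2,3) assms(2)] obtain c w' where "\<forall>s\<in>set w'. snd s = Cup" "is_tangle_word 0 w' (k - 2)"
    and *: "skein_eq 0 (k - 2) (of_word (w @ [(i, Cap)])) (scale c (of_word w'))"
    by blast
  then have "scale c (of_word w') \<in> cup_reducible (k - 2)"
    by (intro cup_reducible_scale cup_reducible_cup_words) (auto simp: cup_words_def)
  with * show "v * of_word [(i, Cap)] \<in> cup_reducible (k - 2)"
    unfolding w of_word_mult by (rule cup_reducible_skein_eq)
qed (use assms(2) in simp)

lemma skein_eq_crossing:
  assumes "i + 2 \<le> k"
  shows "skein_eq k k (of_word [(i, CrossR)]) (scale Avar 1 + scale (inverse Avar) (of_word [(i, Cap), (i, Cup)]))"
    and "skein_eq k k (of_word [(i, CrossL)]) (scale Avar (of_word [(i, Cap), (i, Cup)]) + scale (inverse Avar) 1)"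
proof -
  have *: "shift i r \<in> disk_relations k k" if "local_relation 2 2 r" for r
    using skein_eq_local[OF that, of k "[]" i "k - 2 - i" "[]" k] assms by simp
  show "skein_eq k k (of_word [(i, CrossR)]) (scale Avar 1 + scale (inverse Avar) (of_word [(i, Cap), (i, Cup)]))"
    using *[OF crossing_R] by (simp add: skein_eq_def shift_diff shift_add shift_scale shift_of_word)
  show "skein_eq k k (of_word [(i, CrossL)]) (scale Avar (of_word [(i, Cap), (i, Cup)]) + scale (inverse Avar) 1)"
    using *[OF crossing_L] by (simp add: skein_eq_def shift_diff shift_add shift_scale shift_of_word)
qed

lemma tangle_word_cup_reducible: "is_tangle_word 0 w n \<Longrightarrow> of_word w \<in> cup_reducible n"
proof (induction w arbitrary: n rule: rev_induct)
  case Nil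
  have "of_word [] \<in> cup_words 0"
    unfolding cup_words_def by (intro CollectI exI[of _ "[]"]) simp
  with Nil show ?case by (auto dest: cup_reducible_cup_words)
next
  case (snoc s w)
  obtain i g where s: "s = (i, g)" by force
  from snoc.prems obtain k where k: "is_tangle_word 0 w k" "i + bot_ends g \<le> k"
      "n = k - bot_ends g + top_ends g"
    by (auto simp: is_tangle_word_append s)
  note IH = snoc.IH[OF k(1)]
  have split: "of_word (w @ [s]) = of_word w * of_word [s]"
    by (simp add: of_word_mult)
  have w: "of_word w \<in> tangle_combs 0 k" using k(1) by simp
  have CapCup: "of_word w * of_word [(i, Cap), (i, Cup)] \<in> cup_reducible k" if "i + 2 \<le> k"
  proof -
    have "Suc (Suc (k - 2)) = k" "i \<le> k - 2" using that by auto
    then show ?thesis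
      using cup_reducible_Cup[OF cup_reducible_Cap[OF IH that], of i] by (simp add: of_word_mult)
  qed
  show ?case
  proof (cases g)
    case Cup
    with k show ?thesis using cup_reducible_Cup[OF IH, of i] by (simp add: of_word_mult s)
  next
    case Cap
    with k show ?thesis using cup_reducible_Cap[OF IH, of i] by (simp add: of_word_mult s)
  next
    case CrossR
    with k have i: "i + 2 \<le> k" and n: "n = k" by simp_all
    show ?thesis
      unfolding split unfolding s CrossR n
      by (rule cup_reducible_skein_eq[OF skein_eq_mult_left[OF skein_eq_crossing(1)[OF i] w]])
        (simp add: distrib_left cup_reducible_add cup_reducible_scale IH CapCup[OF i])
  next
    case CrossL
    with k have i: "i + 2 \<le> k" and n: "n = k" by simp_all
    show ?thesis
      unfolding split unfolding s CrossL n
      by (rule cup_reducible_skein_eq[OF skein_eq_mult_left[OF skein_eq_crossing(2)[OF i] w]])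
        (simp add: distrib_left cup_reducible_add cup_reducible_scale IH CapCup[OF i])
  qed
qed

lemma closed_skein_scalar:
  assumes "x \<in> tangle_combs 0 0"
  shows "\<exists>c. skein_eq 0 0 x (scale c 1)"
proof -
  have "x \<in> cup_reducible 0"
    using assms unfolding tangle_combs_eq_span
    by (induction x rule: comb.span_induct_alt)
      (auto simp: cup_reducible_zero intro!: cup_reducible_add cup_reducible_scale tangle_word_cup_reducible)
  then obtain y where y: "y \<in> comb.span (cup_words 0)" "skein_eq 0 0 x y"
    by (auto simp: cup_reducible_def)
  \<comment> \<open>Each cup adds two ends, so the only cup word without ends is the empty
    one.\<close>
  have "n = m + 2 * length v" if "\<forall>s\<in>set v. snd s = Cup" "is_tangle_word m v n" for m n v
    using that
  proof (induction v arbitrary: m)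
    case (Cons s v)
    then obtain i where "s = (i, Cup)" by (cases s) auto
    with Cons.prems Cons.IH[of "m + 2"] show ?case by simp
  qed simp
  then have "cup_words 0 \<subseteq> {1}"
    by (fastforce simp: cup_words_def)
  then have "y \<in> comb.span {1}"
    using y(1) comb.span_mono by blast
  then show ?thesis
    using y(2) by (auto simp: comb.span_singleton)
qed

text \<open>Existence of the scalar comes from the reduction. Uniqueness holds because the
  representation kills the sphere relations and sends the empty link to \<open>1\<close>.\<close>

theorem sphere_eval_eq:
  assumes "x \<in> tangle_combs 0 0"
  shows "sphere_eval x = comb_op x vacuum []"
proof -
  obtain c where c: "skein_eq 0 0 x (scale c 1)"
    using closed_skein_scalar[OF assms] by blast
  then have "x - scale c 1 \<in> sphere_relations"
    unfolding sphere_relations_def skein_eq_def by (blast intro: comb.span_base)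
  moreover have "d = comb_op x vacuum []" if "x - scale d 1 \<in> sphere_relations" for d
    using comb_op_sphere_relations[OF that] by (simp add: vacuum_def)
  ultimately show ?thesis
    unfolding sphere_eval_def by (metis (mono_tags, lifting) the_equality)
qed

section \<open>Quantum integers\<close>

text \<open>Pulling out a power of \<open>- inverse (Avar ^ 2)\<close> leaves a quotient in
  \<open>Avar ^ 4\<close>, the base of the Pochhammer symbols.\<close>

lemma Delta_of_nat:
  "Delta (int n) = (-1) ^ n * inverse (Avar ^ 2) ^ n * ((1 - (Avar ^ 4) ^ Suc n) / (1 - Avar ^ 4))"
proof -
  have A4: "Avar ^ 4 \<noteq> 1" by (simp add: Avar_power_eq_1_iff)
  define u where "u = Avar ^ 2"
  have u: "u \<noteq> 0" "u * u \<noteq> 1" and A: "Avar ^ 4 = u * u"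
    using A4 by (simp_all add: u_def flip: power_add)
  have 1: "Avar powi (2 * (int n + 1)) = u ^ Suc n"
  proof -
    have "2 * (int n + 1) = int (2 * Suc n)" by simp
    then show ?thesis by (simp only: power_int_of_nat u_def power_mult)
  qed
  have 2: "Avar powi (- 2 * (int n + 1)) = inverse (u ^ Suc n)"
    using 1 power_int_minus[of Avar "2 * (int n + 1)"] by simp
  have 3: "Avar powi 2 - Avar powi (- 2) = u - inverse u"
    by (simp add: u_def power_int_minus)
  have "u - inverse u \<noteq> 0"
    using u by (simp add: field_simps)
  then show ?thesis
    using u unfolding Delta_def 1 2 3 A u_def[symmetric]
    by (simp add: power_int_of_nat power_mult_distrib divide_simps) (simp add: algebra_simps)
qed

lemma Delta_minus_1: "Delta (- 1) = 0"
  by (simp add: Delta_def)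

lemma Delta_nonzero: "Delta (int n) \<noteq> 0"
proof -
  have "Avar ^ (4 * Suc n) \<noteq> 1" "Avar ^ 4 \<noteq> 1"
    by (simp_all only: Avar_power_eq_1_iff) simp_all
  then show ?thesis unfolding Delta_of_nat power_mult by simp
qed

text \<open>The Chebyshev recursion, the source of the coefficients in Wenzl's recursion.\<close>

lemma Delta_rec: "loop_value * Delta (int n) = Delta (int n + 1) + Delta (int n - 1)"
proof -
  define u where "u = Avar ^ 2"
  have A4: "Avar ^ 4 \<noteq> 1" by (simp add: Avar_power_eq_1_iff)
  have u: "u \<noteq> 0" "u * u \<noteq> 1" and A: "Avar ^ 4 = u * u"
    using A4 by (simp_all add: u_def flip: power_add)
  define v where "v = 1 - u * u"
  have D: "Delta (int n) = (-1) ^ n * inverse u ^ n * ((1 - (u * u) ^ Suc n) / v)" for n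
    unfolding Delta_of_nat A u_def v_def ..
  have eq: "v \<noteq> 0" using u by (simp add: v_def)
  show ?thesis
  \<comment> \<open>For \<open>n = 0\<close> the index \<open>-1\<close> lies outside the closed
    form; there \<open>Delta\<close> vanishes.\<close>
  proof (cases n)
    case 0
    show ?thesis
    proof -
      have "(1 - (u * u) ^ Suc 1) / v = 1 + u * u"
        using eq by (simp add: v_def divide_eq_eq algebra_simps)
      then have "Delta 0 = 1" "Delta 1 = - inverse u * (1 + u * u)"
        using D[of 0] D[of 1] eq by (simp_all add: v_def)
      then show ?thesis
        using 0 u by (simp add: Delta_minus_1 loop_value_eq field_simps flip: u_def)
    qed
  next
    case (Suc k)
    have "loop_value * Delta (int (Suc k)) = Delta (int (Suc (Suc k))) + Delta (int k)"
      unfolding D loop_value_eq u_def[symmetric]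
      using u eq by (simp add: power_mult_distrib field_simps)
    then show ?thesis using Suc by (simp add: algebra_simps)
  qed
qed


section \<open>Existence of the Jones--Wenzl idempotents\<close>

lemma tl_gen_in_tangle_combs: "Suc i < N \<Longrightarrow> tl_gen i \<in> tangle_combs N N"
  by (auto simp: tl_gen_def)

lemma tl_gen_square:
  assumes "Suc i < N"
  shows "skein_eq N N (tl_gen i * tl_gen i) (scale loop_value (tl_gen i))"
proof -
  have "skein_eq N N (of_word ([(i, Cap)] @ (i, Cup) # (i, Cap) # [(i, Cup)]))
          (scale loop_value (of_word ([(i, Cap)] @ [(i, Cup)])))"
    by (rule skein_eq_circle[of _ _ _ "N - 2 - i"]) (use assms in auto)
  then show ?thesis by (simp add: tl_gen_def of_word_mult)
qed

lemma tl_gen_braid_down: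
  assumes "Suc (Suc i) < N"
  shows "skein_eq N N (tl_gen (Suc i) * tl_gen i * tl_gen (Suc i)) (tl_gen (Suc i))"
proof -
  obtain b where N: "N = i + 3 + b"
    using less_imp_Suc_add[OF assms] by auto
  have "skein_eq N N (of_word ([(Suc i, Cap)] @ (Suc i, Cup) # (i, Cap) # [(i, Cup), (Suc i, Cap), (Suc i, Cup)]))
          (of_word ([(Suc i, Cap)] @ [(i, Cup), (Suc i, Cap), (Suc i, Cup)]))"
    by (rule skein_eq_straighten_right[of _ _ _ b]) (use N in auto)
  also have "skein_eq N N \<dots> (of_word ([(Suc i, Cap)] @ [(Suc i, Cup)]))"
    using skein_eq_straighten_left[of N "[(Suc i, Cap)]" i b "[(Suc i, Cup)]" N] N by auto
  finally show ?thesis by (simp add: tl_gen_def of_word_mult)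
qed

lemma tl_gen_commute:
  assumes "i + 2 \<le> j" "Suc j < N"
  shows "skein_eq N N (tl_gen i * tl_gen j) (tl_gen j * tl_gen i)"
proof -
  obtain c where j: "j = i + 2 + c" using assms(1) le_Suc_ex by blast
  let ?b = "N - 2 - j"
  have N: "N = i + 2 + c + 2 + ?b" using assms j by simp
  have "skein_eq N N (of_word ([(i, Cap)] @ (i, Cup) # (i + 2 + c, Cap) # [(j, Cup)]))
          (of_word ([(i, Cap)] @ (i + c, Cap) # (i, Cup) # [(j, Cup)]))"
    using skein_eq_exchange[of N "[(i, Cap)]" i Cup c Cap ?b "[(j, Cup)]" N] N j assms by auto
  also have "skein_eq N N \<dots> (of_word ((i + 2 + c, Cap) # (i, Cap) # [(i, Cup), (j, Cup)]))"
    using skein_eq_exchange[of N "[]" i Cap c Cap ?b "[(i, Cup), (j, Cup)]" N] N j assms by auto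
  also have "skein_eq N N \<dots> (of_word ([(j, Cap), (i, Cap)] @ (i + c, Cup) # (i, Cup) # []))"
    using skein_eq_exchange[of N "[(j, Cap), (i, Cap)]" i Cup c Cup ?b "[]" N] N j assms by auto
  also have "skein_eq N N \<dots> (of_word ([(j, Cap)] @ (i + 2 + c, Cup) # (i, Cap) # [(i, Cup)]))"
    using skein_eq_exchange[of N "[(j, Cap)]" i Cap c Cup ?b "[(i, Cup)]" N] N j assms by auto
  finally show ?thesis by (simp add: tl_gen_def of_word_mult j)
qed


text \<open>Wenzl's recursion; the first case differs because \<open>k - 1\<close> would truncate.\<close>

fun wenzl :: "nat \<Rightarrow> comb" where
  "wenzl 0 = 1"
| "wenzl (Suc 0) = 1"
| "wenzl (Suc (Suc k)) = wenzl (Suc k) - scale (Delta (int k) / Delta (int k + 1))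
      (wenzl (Suc k) * tl_gen k * wenzl (Suc k))"

lemma wenzl_in_tangle_combs: "n \<le> N \<Longrightarrow> wenzl n \<in> tangle_combs N N"
  by (induction n rule: wenzl.induct)
    (auto intro!: tangle_combs_one tangle_combs_diff tangle_combs_scale tangle_combs_mult tl_gen_in_tangle_combs)

lemmas tangle_combs_mult_square = tangle_combs_mult[of _ n n _ n] for n

lemma skein_eq_mult_mid:
  assumes "skein_eq n n x y" "v \<in> tangle_combs n n" "w \<in> tangle_combs n n"
  shows "skein_eq n n (v * x * w) (v * y * w)"
  by (rule skein_eq_mult_right[OF skein_eq_mult_left[OF assms(1,2)] assms(3)])

text \<open>\<open>wenzl n\<close> is built from generators \<open>tl_gen i\<close> with
  \<open>i + 2 \<le> n \<le> j\<close>, all distant from \<open>tl_gen j\<close>.\<close>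

lemma tl_gen_wenzl_commute:
  "n \<le> j \<Longrightarrow> Suc j < N \<Longrightarrow> skein_eq N N (tl_gen j * wenzl n) (wenzl n * tl_gen j)"
proof (induction n rule: wenzl.induct)
  case (3 k)
  let ?F = "wenzl (Suc k)" and ?e = "tl_gen k" and ?j = "tl_gen j"
  note in_T = wenzl_in_tangle_combs[of "Suc k" N] tl_gen_in_tangle_combs[of _ N]
  have T: "?F \<in> tangle_combs N N" "?e \<in> tangle_combs N N" "?j \<in> tangle_combs N N"
    using 3 by (auto intro!: in_T)
  have jF: "skein_eq N N (?j * ?F) (?F * ?j)" using 3 by simp
  have je: "skein_eq N N (?e * ?j) (?j * ?e)" using 3 by (intro tl_gen_commute) auto
  have "skein_eq N N (?j * ?F * (?e * ?F)) (?F * ?j * (?e * ?F))"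
    by (intro skein_eq_mult_right[OF jF] tangle_combs_mult_square T)
  also have "skein_eq N N (?F * ?j * (?e * ?F)) (?F * (?e * ?j) * ?F)"
    unfolding mult.assoc[of ?F ?j] mult.assoc[symmetric, of ?j]
    unfolding mult.assoc[symmetric, of ?F "?j * ?e"]
    by (intro skein_eq_mult_mid skein_eq_sym[OF je] T)
  also have "skein_eq N N (?F * (?e * ?j) * ?F) (?F * ?e * (?F * ?j))"
    using skein_eq_mult_left[OF jF, of "?F * ?e" N] T by (simp add: mult.assoc tangle_combs_mult_square)
  finally have "skein_eq N N (?j * (?F * ?e * ?F)) (?F * ?e * ?F * ?j)"
    by (simp add: mult.assoc)
  then have "skein_eq N N (?j * ?F - scale c (?j * (?F * ?e * ?F))) (?F * ?j - scale c (?F * ?e * ?F * ?j))" for c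
    by (intro skein_eq_diff skein_eq_scale jF)
  then show ?case
    by (simp add: left_diff_distrib right_diff_distrib)
qed simp_all

text \<open>One step of the recursion in abstract form, meant for \<open>F\<close> and
  \<open>P\<close> of index \<open>k + 1\<close> and \<open>k\<close> and
  \<open>e = tl_gen k\<close>. Modulo relations, \<open>eFe\<close> yields
  \<open>e * (F * e * F) = d * (e * F)\<close>; since \<open>c * d = 1\<close>, the correction term
  cancels \<open>e * F\<close>.\<close>

lemma wenzl_step:
  assumes T: "F \<in> tangle_combs N N" "P \<in> tangle_combs N N" "e \<in> tangle_combs N N"
    and FF: "skein_eq N N (F * F) F" and FP: "skein_eq N N (F * P) F" and PF: "skein_eq N N (P * F) F"
    and eFe: "skein_eq N N (e * F * e) (scale d (P * e))" and eP: "skein_eq N N (e * P) (P * e)"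
    and cd: "c * d = 1"
  defines "G \<equiv> F - scale c (F * e * F)"
  shows "skein_eq N N (G * F) G" "skein_eq N N (F * G) G" "skein_eq N N (G * G) G"
    "skein_eq N N (e * G) 0" "skein_eq N N (G * e) 0"
proof -
  let ?X = "F * e * F"
  note T' = T tangle_combs_mult_square tangle_combs_scale tangle_combs_diff
  have XF: "skein_eq N N (?X * F) ?X"
    using skein_eq_mult_left[OF FF, of "F * e" N] T' by (simp add: mult.assoc)
  have FX: "skein_eq N N (F * ?X) ?X"
    using skein_eq_mult_right[OF FF, of "e * F" N] T' by (simp add: mult.assoc)
  have PeF: "skein_eq N N (P * e * F) (e * F)"
  proof -
    have "skein_eq N N (P * e * F) (e * P * F)"
      by (intro skein_eq_mult_right[OF skein_eq_sym[OF eP]] T')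
    also have "skein_eq N N (e * P * F) (e * F)"
      using skein_eq_mult_left[OF PF, of e N] T' by (simp add: mult.assoc)
    finally show ?thesis .
  qed
  have eX: "skein_eq N N (e * ?X) (scale d (e * F))"
  proof -
    have "skein_eq N N (e * F * e * F) (scale d (P * e) * F)"
      by (intro skein_eq_mult_right[OF eFe] T')
    also have "skein_eq N N (scale d (P * e) * F) (scale d (e * F))"
      using skein_eq_scale[OF PeF] by simp
    finally show ?thesis by (simp add: mult.assoc)
  qed
  have Xe: "skein_eq N N (?X * e) (scale d (F * e))"
  proof -
    have "skein_eq N N (F * (e * F * e)) (F * scale d (P * e))"
      by (intro skein_eq_mult_left[OF eFe] T')
    also have "skein_eq N N (F * scale d (P * e)) (scale d (F * e))"
      using skein_eq_scale[OF skein_eq_mult_right[OF FP T(3)]] by (simp add: mult.assoc)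
    finally show ?thesis by (simp add: mult.assoc)
  qed
  have XX: "skein_eq N N (?X * ?X) (scale d ?X)"
  proof -
    have "skein_eq N N (?X * ?X) (F * e * ?X)"
      using skein_eq_mult_left[OF FX, of "F * e" N] T' by (simp add: mult.assoc)
    also have "skein_eq N N (F * e * ?X) (F * scale d (e * F))"
      using skein_eq_mult_left[OF eX, of F N] T' by (simp add: mult.assoc)
    finally show ?thesis by (simp add: mult.assoc)
  qed
  show GF: "skein_eq N N (G * F) G"
    unfolding G_def using skein_eq_diff[OF FF skein_eq_scale[OF XF, of c]]
    by (simp add: left_diff_distrib)
  show FG: "skein_eq N N (F * G) G"
    unfolding G_def using skein_eq_diff[OF FF skein_eq_scale[OF FX, of c]]
    by (simp add: right_diff_distrib)
  show "skein_eq N N (e * G) 0"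
    unfolding G_def using skein_eq_diff[OF skein_eq_refl[of N N "e * F"] skein_eq_scale[OF eX, of c]]
    by (simp add: right_diff_distrib cd)
  show "skein_eq N N (G * e) 0"
    unfolding G_def using skein_eq_diff[OF skein_eq_refl[of N N "F * e"] skein_eq_scale[OF Xe, of c]]
    by (simp add: left_diff_distrib cd)
  have "skein_eq N N (G * ?X) 0"
    unfolding G_def using skein_eq_diff[OF FX skein_eq_scale[OF XX, of c]]
    by (simp add: left_diff_distrib cd)
  moreover have "G * G = G * F - scale c (G * ?X)"
    by (subst (2) G_def) (simp add: right_diff_distrib)
  ultimately show "skein_eq N N (G * G) G"
    using skein_eq_diff[OF GF skein_eq_scale, of "G * ?X" 0 c] by simp
qed

text \<open>This passes the hypothesis \<open>eFe\<close> of the abstract step on to the next index,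
  with \<open>e'\<close> the next generator. As \<open>e'\<close> commutes with \<open>F\<close>,
  the main term closes a loop of value \<open>l\<close>, and in the correction term
  \<open>e' * e * e'\<close> shrinks to \<open>e'\<close>.\<close>

lemma wenzl_pop:
  assumes T: "F \<in> tangle_combs N N" "e \<in> tangle_combs N N" "e' \<in> tangle_combs N N"
    and FF: "skein_eq N N (F * F) F" and e'F: "skein_eq N N (e' * F) (F * e')"
    and e'e': "skein_eq N N (e' * e') (scale l e')" and e'ee': "skein_eq N N (e' * e * e') e'"
  shows "skein_eq N N (e' * (F - scale c (F * e * F)) * e') (scale (l - c) (F * e'))"
proof -
  note T' = T tangle_combs_mult_square
  have "skein_eq N N (e' * F * e') (F * e' * e')"
    by (intro skein_eq_mult_right[OF e'F] T')
  also have "skein_eq N N (F * e' * e') (F * scale l e')"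
    using skein_eq_mult_left[OF e'e', of F N] T' by (simp add: mult.assoc)
  finally have 1: "skein_eq N N (e' * F * e') (scale l (F * e'))" by simp
  have "skein_eq N N (e' * F * (e * F * e')) (F * e' * (e * F * e'))"
    by (intro skein_eq_mult_right[OF e'F] T')
  also have "skein_eq N N (F * e' * (e * F * e')) (F * e' * e * (e' * F))"
    using skein_eq_mult_left[OF skein_eq_sym[OF e'F], of "F * e' * e" N] T' by (simp add: mult.assoc)
  also have "skein_eq N N (F * e' * e * (e' * F)) (F * e' * F)"
    using skein_eq_mult_mid[OF e'ee', of F F] T' by (simp add: mult.assoc)
  also have "skein_eq N N (F * e' * F) (F * (F * e'))"
    using skein_eq_mult_left[OF e'F, of F N] T' by (simp add: mult.assoc)
  also have "skein_eq N N (F * (F * e')) (F * e')"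
    using skein_eq_mult_right[OF FF, of e' N] T' by (simp add: mult.assoc)
  finally have 2: "skein_eq N N (e' * (F * e * F) * e') (F * e')" by (simp add: mult.assoc)
  show ?thesis
    using skein_eq_diff[OF 1 skein_eq_scale[OF 2, of c]]
    by (simp add: left_diff_distrib right_diff_distrib comb.scale_left_diff_distrib)
qed

text \<open>The claims go through one common induction because each feeds the next step. The last
  one supplies the partial trace with which the next idempotent is normalized.\<close>

lemma wenzl_properties:
  "Suc k \<le> N \<Longrightarrow>
     skein_eq N N (wenzl (Suc k) * wenzl (Suc k)) (wenzl (Suc k))
   \<and> skein_eq N N (wenzl (Suc k) * wenzl k) (wenzl (Suc k))
   \<and> skein_eq N N (wenzl k * wenzl (Suc k)) (wenzl (Suc k))
   \<and> (\<forall>i<k. skein_eq N N (tl_gen i * wenzl (Suc k)) 0 \<and> skein_eq N N (wenzl (Suc k) * tl_gen i) 0)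
   \<and> (Suc k < N \<longrightarrow> skein_eq N N (tl_gen k * wenzl (Suc k) * tl_gen k)
        (scale (Delta (int k + 1) / Delta (int k)) (wenzl k * tl_gen k)))"
proof (induction k)
  case 0
  have "Delta 0 = 1" using Delta_of_nat[of 0] by (simp add: Avar_power_eq_1_iff)
  moreover have "Delta 1 = loop_value"
    using Delta_rec[of 0] Delta_minus_1 calculation by simp
  ultimately show ?case
    using tl_gen_square[of 0 N] by simp
next
  case (Suc k)
  let ?F = "wenzl (Suc k)" and ?P = "wenzl k" and ?e = "tl_gen k" and ?G = "wenzl (Suc (Suc k))"
  let ?c = "Delta (int k) / Delta (int k + 1)" and ?d = "Delta (int k + 1) / Delta (int k)"
  have T: "?F \<in> tangle_combs N N" "?P \<in> tangle_combs N N" "?e \<in> tangle_combs N N"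
    using Suc.prems by (auto intro!: wenzl_in_tangle_combs tl_gen_in_tangle_combs)
  have IH: "skein_eq N N (?F * ?F) ?F" "skein_eq N N (?F * ?P) ?F" "skein_eq N N (?P * ?F) ?F"
      "skein_eq N N (?e * ?F * ?e) (scale ?d (?P * ?e))"
    and kill: "\<And>i. i < k \<Longrightarrow> skein_eq N N (tl_gen i * ?F) 0 \<and> skein_eq N N (?F * tl_gen i) 0"
    using Suc by auto
  have nz: "Delta (int k) \<noteq> 0" "Delta (int k + 1) \<noteq> 0"
    using Delta_nonzero[of k] Delta_nonzero[of "Suc k"] by (simp_all add: add.commute)
  have eP: "skein_eq N N (?e * ?P) (?P * ?e)"
    using Suc.prems by (intro tl_gen_wenzl_commute) auto
  have cd: "?c * ?d = 1" using nz by simp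
  note step = wenzl_step[OF T IH eP cd, folded wenzl.simps(3)]
  have G: "?G = ?F - scale ?c (?F * ?e * ?F)" by simp
  \<comment> \<open>\<open>?G\<close> begins and ends with \<open>?F\<close>, which already kills
    the generators below \<open>k\<close>; only \<open>tl_gen k\<close> is new.\<close>
  have "skein_eq N N (tl_gen i * ?G) 0 \<and> skein_eq N N (?G * tl_gen i) 0" if "i < Suc k" for i
  proof (cases "i = k")
    case False
    with that kill have ki: "skein_eq N N (tl_gen i * ?F) 0" "skein_eq N N (?F * tl_gen i) 0" by auto
    have eF: "?e * ?F \<in> tangle_combs N N" and Fe: "?F * ?e \<in> tangle_combs N N"
      by (intro tangle_combs_mult_square T)+
    have "skein_eq N N (tl_gen i * ?F - scale ?c (tl_gen i * ?F * (?e * ?F))) (0 - scale ?c (0 * (?e * ?F)))"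
      by (intro skein_eq_diff skein_eq_scale skein_eq_mult_right[OF ki(1) eF] ki)
    moreover have "skein_eq N N (?F * tl_gen i - scale ?c (?F * ?e * (?F * tl_gen i))) (0 - scale ?c (?F * ?e * 0))"
      by (intro skein_eq_diff skein_eq_scale skein_eq_mult_left[OF ki(2) Fe] ki)
    ultimately show ?thesis unfolding G
      by (simp add: left_diff_distrib right_diff_distrib mult.assoc)
  qed (use step nz Suc.prems in auto)
  moreover have "skein_eq N N (tl_gen (Suc k) * ?G * tl_gen (Suc k))
      (scale (loop_value - ?c) (?F * tl_gen (Suc k)))" if "Suc (Suc k) < N"
    unfolding G using that
    by (intro wenzl_pop T IH tl_gen_wenzl_commute tl_gen_square tl_gen_braid_down tl_gen_in_tangle_combs) auto
  \<comment> \<open>By the Chebyshev recursion the new partial trace is again a quotient of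
    consecutive values of \<open>Delta\<close>.\<close>
  moreover have "loop_value - ?c = Delta (int (Suc k) + 1) / Delta (int (Suc k))"
    using Delta_rec[of "Suc k"] nz by (simp add: field_simps)
  ultimately show ?case
    using step nz Suc.prems by (simp del: wenzl.simps(3))
qed

lemma tl_subalgebra_mult:
  assumes "x \<in> tl_subalgebra n" "y \<in> tl_subalgebra n"
  shows "x * y \<in> tl_subalgebra n"
proof -
  have word: "prod_list (map tl_gen is) * y \<in> tl_subalgebra n" if "is \<noteq> []" "\<forall>i\<in>set is. i + 1 < n" for "is"
    using assms(2) unfolding tl_subalgebra_def
  proof (induction y rule: comb.span_induct_alt)
    case (step c y z)
    then obtain js where y: "y = prod_list (map tl_gen js)" "\<forall>i\<in>set js. i + 1 < n" by blast
    have "prod_list (map tl_gen is) * y = prod_list (map tl_gen (is @ js))"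
      by (simp add: y)
    moreover have "\<forall>i\<in>set (is @ js). i + 1 < n" "is @ js \<noteq> []" using that y(2) by auto
    ultimately have "prod_list (map tl_gen is) * y
        \<in> {prod_list (map tl_gen is) | is. is \<noteq> [] \<and> (\<forall>i\<in>set is. i + 1 < n)}"
      by blast
    with step(2) show ?case
      by (simp add: distrib_left comb.span_add comb.span_scale comb.span_base)
  qed (simp add: comb.span_zero)
  show ?thesis
    using assms(1) unfolding tl_subalgebra_def[of n]
  proof (induction x rule: comb.span_induct_alt)
    case (step c x z)
    then show ?case using word unfolding tl_subalgebra_def[of n]
      by (auto simp: distrib_right intro!: comb.span_add comb.span_scale)
  qed (simp add: comb.span_zero)
qed

lemma tl_gen_in_tl_subalgebra: "Suc i < n \<Longrightarrow> tl_gen i \<in> tl_subalgebra n"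
  unfolding tl_subalgebra_def by (intro comb.span_base CollectI exI[of _ "[i]"]) simp

lemma tl_subalgebra_mono: "m \<le> n \<Longrightarrow> tl_subalgebra m \<subseteq> tl_subalgebra n"
  unfolding tl_subalgebra_def by (intro comb.span_mono) fastforce

lemma wenzl_unital: "wenzl n - 1 \<in> tl_subalgebra n"
proof (induction n rule: wenzl.induct)
  case (3 k)
  let ?S = "tl_subalgebra (Suc (Suc k))" and ?e = "tl_gen k"
  have add: "x + y \<in> ?S" "x - y \<in> ?S" if "x \<in> ?S" "y \<in> ?S" for x y
    using that by (simp_all add: tl_subalgebra_def comb.span_add comb.span_diff)
  have scale: "scale c x \<in> ?S" if "x \<in> ?S" for x c
    using that by (simp add: tl_subalgebra_def comb.span_scale)
  define u where "u = wenzl (Suc k) - 1"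
  have u: "u \<in> ?S" and e: "?e \<in> ?S"
    using 3 tl_subalgebra_mono[of "Suc k" "Suc (Suc k)"]
    by (auto simp: u_def intro: tl_gen_in_tl_subalgebra)
  have F: "wenzl (Suc k) = 1 + u" by (simp add: u_def)
  have "u - scale c (?e + u * ?e + (?e * u + u * ?e * u)) \<in> ?S" for c
    by (intro add scale tl_subalgebra_mult u e)
  then show ?case by (simp add: F distrib_left distrib_right add_ac)
qed (simp_all add: tl_subalgebra_def comb.span_zero)

lemma is_jones_wenzl_wenzl: "is_jones_wenzl n (wenzl n)"
proof -
  have "wenzl n = 1 + (wenzl n - 1)" by simp
  then have "\<exists>u\<in>tl_subalgebra n. skein_eq n n (wenzl n) (1 + u)"
    using wenzl_unital skein_eq_refl by metis
  then show ?thesis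
    using wenzl_properties[of "n - 1" n]
    by (cases n) (auto simp: is_jones_wenzl_def wenzl_in_tangle_combs tangle_combs_one simp del: wenzl.simps(3))
qed

text \<open>Wenzl's recursion provides the witness that the choice requires. The action of the
  chosen representative is then derived from the defining properties.\<close>

lemma is_jones_wenzl_jones_wenzl: "is_jones_wenzl n (jones_wenzl n)"
  unfolding jones_wenzl_def by (rule someI) (rule is_jones_wenzl_wenzl)

section \<open>The image of the Jones--Wenzl idempotents\<close>

abbreviation zeros :: "bool list \<Rightarrow> nat" where
  "zeros s \<equiv> count_list s False"

abbreviation ones :: "bool list \<Rightarrow> nat" where
  "ones s \<equiv> count_list s True"

lemma zeros_plus_ones: "zeros s + ones s = length s"
proof (induction s)
  case (Cons a s)
  then show ?case by (cases a) auto
qed simp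

primrec inversions :: "bool list \<Rightarrow> nat" where
  "inversions [] = 0"
| "inversions (a # s) = (if a then zeros s else 0) + inversions s"

lemma inversions_append: "inversions (s @ t) = inversions s + inversions t + ones s * zeros t"
proof (induction s)
  case (Cons a s)
  then show ?case by (cases a) auto
qed simp

definition weight :: "bool list \<Rightarrow> qA" where
  "weight s = (Avar ^ 2) ^ inversions s"

lemma weight_simps [simp]:
  "weight [] = 1" "weight (False # s) = weight s" "weight (True # s) = (Avar ^ 2) ^ zeros s * weight s"
  by (simp_all add: weight_def power_add)

definition bits :: "nat \<Rightarrow> bool list set" where
  "bits n = {s. length s = n}"

lemma finite_bits [simp]: "finite (bits n)"
  using finite_lists_length_eq[of "UNIV :: bool set" n] by (simp add: bits_def)

lemma bits_0 [simp]: "bits 0 = {[]}"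
  by (auto simp: bits_def)

lemma sum_bits_Suc:
  "(\<Sum>s\<in>bits (Suc n). f s) = (\<Sum>s\<in>bits n. f (False # s)) + (\<Sum>s\<in>bits n. f (True # s))"
proof -
  have "bits (Suc n) = (#) False ` bits n \<union> (#) True ` bits n"
    by (auto simp: bits_def length_Suc_conv)
  then have "(\<Sum>s\<in>bits (Suc n). f s) = (\<Sum>s\<in>(#) False ` bits n. f s) + (\<Sum>s\<in>(#) True ` bits n. f s)"
    by (simp, intro sum.union_disjoint) auto
  then show ?thesis by (simp add: sum.reindex)
qed

lemma sum_bits_add: "(\<Sum>s\<in>bits (m + n). f s) = (\<Sum>x\<in>bits m. \<Sum>y\<in>bits n. f (x @ y))"
  by (induction m arbitrary: f) (simp_all add: sum_bits_Suc)

text \<open>The coordinate pairing with the q-symmetric tensor having \<open>w\<close> ones, whose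
  coordinates are the values of \<open>weight\<close>.\<close>

definition weight_sum :: "nat \<Rightarrow> nat \<Rightarrow> state \<Rightarrow> qA" where
  "weight_sum n w f = (\<Sum>s\<in>bits n. if ones s = w then weight s * f s else 0)"

lemma weight_sum_cong:
  "(\<And>s. length s = n \<Longrightarrow> ones s = w \<Longrightarrow> f s = h s) \<Longrightarrow> weight_sum n w f = weight_sum n w h"
  by (auto simp: weight_sum_def bits_def intro!: sum.cong)

lemma weight_sum_add: "weight_sum n w (\<lambda>s. f s + h s) = weight_sum n w f + weight_sum n w h"
  unfolding weight_sum_def sum.distrib[symmetric] by (rule sum.cong) (simp_all add: distrib_left)

lemma weight_sum_scale: "weight_sum n w (\<lambda>s. c * f s) = c * weight_sum n w f"
  unfolding weight_sum_def sum_distrib_left by (rule sum.cong) simp_all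

lemma weight_sum_zero [simp]: "weight_sum n w (\<lambda>s. 0) = 0"
  by (simp add: weight_sum_def cong: if_cong)

lemma ones_le_length: "ones s \<le> length s"
  using zeros_plus_ones[of s] by simp

lemma weight_sum_large: "n < w \<Longrightarrow> weight_sum n w f = 0"
  unfolding weight_sum_def
proof (intro sum.neutral ballI)
  fix s assume "n < w" "s \<in> bits n"
  then show "(if ones s = w then weight s * f s else 0) = 0"
    using ones_le_length[of s] by (auto simp: bits_def)
qed

lemma weight_sum_0: "weight_sum 0 w f = (if w = 0 then f [] else 0)"
  by (auto simp: weight_sum_def)

text \<open>A leading \<open>True\<close> is inverted with each of the \<open>n - w\<close> zeros
  behind it; a leading \<open>False\<close> creates no inversion.\<close>

lemma weight_sum_Suc:
  "weight_sum (Suc n) 0 f = weight_sum n 0 (\<lambda>s. f (False # s))"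
  "weight_sum (Suc n) (Suc w) f =
     weight_sum n (Suc w) (\<lambda>s. f (False # s)) + (Avar ^ 2) ^ (n - w) * weight_sum n w (\<lambda>s. f (True # s))"
proof -
  show "weight_sum (Suc n) 0 f = weight_sum n 0 (\<lambda>s. f (False # s))"
    by (simp add: weight_sum_def sum_bits_Suc cong: if_cong)
  have z: "zeros s = n - w" if "length s = n" "ones s = w" for s
    using zeros_plus_ones[of s] that by simp
  show "weight_sum (Suc n) (Suc w) f =
     weight_sum n (Suc w) (\<lambda>s. f (False # s)) + (Avar ^ 2) ^ (n - w) * weight_sum n w (\<lambda>s. f (True # s))"
    unfolding weight_sum_def sum_bits_Suc sum_distrib_left
    by (intro arg_cong2[where f = "(+)"] sum.cong) (auto simp: z bits_def)
qed

definition weight_norm :: "nat \<Rightarrow> nat \<Rightarrow> qA" where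
  "weight_norm n w = weight_sum n w weight"

lemma weight_norm_Suc:
  "weight_norm (Suc n) 0 = weight_norm n 0"
  "weight_norm (Suc n) (Suc w) = weight_norm n (Suc w) + (Avar ^ 4) ^ (n - w) * weight_norm n w"
proof -
  have "weight_sum n w (\<lambda>s. weight (True # s)) = weight_sum n w (\<lambda>s. (Avar ^ 2) ^ (n - w) * weight s)"
  proof (rule weight_sum_cong)
    fix s assume "length s = n" "ones s = w"
    then have "zeros s = n - w" using zeros_plus_ones[of s] by simp
    then show "weight (True # s) = (Avar ^ 2) ^ (n - w) * weight s" by simp
  qed
  moreover have "(Avar ^ 2) ^ k * (Avar ^ 2) ^ k = (Avar ^ 4) ^ k" for k
    by (simp flip: power_add power_mult)
  ultimately show "weight_norm (Suc n) (Suc w) = weight_norm n (Suc w) + (Avar ^ 4) ^ (n - w) * weight_norm n w"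
    by (simp add: weight_norm_def weight_sum_Suc weight_sum_scale del: weight_simps(3) flip: mult.assoc)
qed (simp add: weight_norm_def weight_sum_Suc)

lemma q_pochhammer_Suc: "q_pochhammer q q (Suc n) = q_pochhammer q q n * (1 - q ^ Suc n)"
  by (simp add: q_pochhammer_def)

lemma q_pochhammer_nonzero: "q_pochhammer (Avar ^ 4) (Avar ^ 4) n \<noteq> 0"
proof -
  have "(Avar ^ 4) ^ Suc j \<noteq> 1" for j
    unfolding power_mult[symmetric] Avar_power_eq_1_iff by simp
  then have "1 - Avar ^ 4 * (Avar ^ 4) ^ j \<noteq> 0" for j
    by simp
  then show ?thesis by (simp add: q_pochhammer_def)
qed

text \<open>The generating function of inversions over words of fixed content is a Gaussian
  binomial; both sides satisfy the same q-Pascal rule.\<close>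

lemma weight_norm_eq: "w \<le> n \<Longrightarrow> weight_norm n w = q_binomial (Avar ^ 4) n w"
proof (induction n arbitrary: w)
  case 0
  then show ?case by (simp add: weight_norm_def weight_sum_0 q_binomial_def q_pochhammer_def)
next
  case (Suc n)
  note nz = q_pochhammer_nonzero
  show ?case
  proof (cases w)
    case 0
    then show ?thesis
      using Suc.IH[of 0] nz by (simp add: weight_norm_Suc q_binomial_def)
  next
    case (Suc v)
    show ?thesis
    \<comment> \<open>\<open>weight_norm n (Suc n)\<close> vanishes, whereas
      \<open>q_binomial\<close> with its truncated subtraction does not, so the top weight is
      separate.\<close>
    proof (cases "v = n")
      case True
      then show ?thesis
        using Suc Suc.IH[of n] nz weight_sum_large[of n "Suc n"]
        by (simp add: weight_norm_Suc q_binomial_def) (simp add: weight_norm_def q_pochhammer_def)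
    next
      case False
      with Suc Suc.prems obtain d where n: "n = Suc (v + d)"
        using less_imp_Suc_add[of v n] by auto
      have 1: "1 - Avar ^ 4 * (Avar ^ 4) ^ j \<noteq> 0" for j
        using nz[of "Suc j"] by (simp add: q_pochhammer_Suc)
      let ?q = "Avar ^ 4"
      let ?p = "q_pochhammer ?q ?q"
      define P where "P = ?p n"
      have pn: "?p (Suc n) = P * (1 - ?q ^ Suc v * ?q ^ Suc d)"
        unfolding q_pochhammer_Suc P_def power_add[symmetric] using n by simp
      have "weight_norm (Suc n) w = ?p n / (?p (Suc v) * ?p d) + ?q ^ Suc d * (?p n / (?p v * ?p (Suc d)))"
        unfolding Suc weight_norm_Suc using Suc.IH[of v] Suc.IH[of "Suc v"] n by (simp add: q_binomial_def)
      also have "\<dots> = ?p (Suc n) / (?p (Suc v) * ?p (Suc d))"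
        using nz[of v] nz[of d] 1[of v] 1[of d]
        unfolding pn P_def[symmetric] q_pochhammer_Suc[of _ v] q_pochhammer_Suc[of _ d]
        by (simp add: divide_simps) (simp add: algebra_simps)
      finally show ?thesis using Suc n by (simp add: q_binomial_def)
    qed
  qed
qed

lemma weight_norm_nonzero: "w \<le> n \<Longrightarrow> weight_norm n w \<noteq> 0"
  by (simp add: weight_norm_eq q_binomial_def q_pochhammer_nonzero)

lemma weight_norm_0 [simp]: "weight_norm n 0 = 1"
  by (simp add: weight_norm_eq q_binomial_def q_pochhammer_nonzero) (simp add: q_pochhammer_def)

lemma weight_norm_symmetric: "w \<le> n \<Longrightarrow> weight_norm n (n - w) = weight_norm n w"
  by (simp add: weight_norm_eq q_binomial_def mult.commute)

text \<open>In the two words differing only in the letters of the cup, \<open>True, False\<close>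
  has one inversion more, hence an extra factor \<open>Avar ^ 2\<close>. This cancels the
  coefficient \<open>- (Avar ^ 2)\<close> at \<open>False, True\<close>.\<close>

lemma weight_sum_slice_op_Cup: "i + 2 \<le> n \<Longrightarrow> weight_sum n w (slice_op i Cup f) = 0"
proof (induction i arbitrary: n w f)
  case 0
  then obtain k where n: "n = Suc (Suc k)" by (metis add_2_eq_Suc le_Suc_ex add_0)
  have "(if ones (False # True # s) = w then weight (False # True # s) * cup_op f (False # True # s) else 0)
      + (if ones (True # False # s) = w then weight (True # False # s) * cup_op f (True # False # s) else 0) = 0"
    for s by simp
  then have "(\<Sum>s\<in>bits k. if ones (False # True # s) = w then weight (False # True # s) * cup_op f (False # True # s) else 0)
      + (\<Sum>s\<in>bits k. if ones (True # False # s) = w then weight (True # False # s) * cup_op f (True # False # s) else 0) = 0"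
    by (simp only: sum.distrib[symmetric] sum.neutral_const)
  then show ?case by (simp add: weight_sum_def n sum_bits_Suc cong: if_cong)
next
  case (Suc i)
  then obtain k where n: "n = Suc k" "i + 2 \<le> k" by (cases n) auto
  then show ?case by (cases w) (simp_all add: weight_sum_Suc Suc.IH)
qed

text \<open>The coordinate with \<open>True, False\<close> on the cup returns the original state.
  Thus from a vanishing product with \<open>tl_gen i\<close> the cup can be removed, leaving a
  vanishing cap.\<close>

lemma slice_op_Cup_inject:
  "slice_op i Cup f = (\<lambda>s. 0) \<Longrightarrow> i \<le> length s \<Longrightarrow> f s = 0"
proof (induction i arbitrary: f s)
  case 0
  then have "slice_op 0 Cup f (True # False # s) = 0" by simp
  then show ?case by simp
next
  case (Suc i)
  then obtain a t where s: "s = a # t" by (cases s) auto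
  have "slice_op i Cup (\<lambda>t. f (a # t)) = (\<lambda>t. 0)"
  proof
    fix t
    show "slice_op i Cup (\<lambda>t. f (a # t)) t = 0"
      using fun_cong[OF Suc.prems(1), of "a # t"] by simp
  qed
  from Suc.IH[OF this] show ?case using Suc.prems s by simp
qed

text \<open>A vanishing cap says that swapping \<open>False, True\<close> into
  \<open>True, False\<close> multiplies the coordinate by \<open>Avar ^ 2\<close>, exactly one
  inversion. Coordinates with equal numbers of ones are therefore tied together.\<close>

lemma symmetric_state:
  assumes "\<And>i s. i \<le> length s \<Longrightarrow> length s + 2 = n \<Longrightarrow> slice_op i Cap f s = 0"
  shows "\<exists>Y. \<forall>s. length s = n \<longrightarrow> f s = weight s * Y (ones s)"
  using assms
proof (induction n arbitrary: f)
  case 0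
  show ?case by (intro exI[of _ "\<lambda>_. f []"]) auto
next
  case (Suc n)
  have "slice_op i Cap (\<lambda>t. f (a # t)) s = 0" if "i \<le> length s" "length s + 2 = n" for a i s
    using Suc.prems[of "Suc i" "a # s"] that by simp
  from Suc.IH[OF this] have "\<exists>Y. \<forall>s. length s = n \<longrightarrow> f (a # s) = weight s * Y (ones s)" for a
    by blast
  then obtain Y where Y: "\<And>a s. length s = n \<Longrightarrow> f (a # s) = weight s * Y a (ones s)"
    by metis
  have count: "count_list (replicate k a) b = (if a = b then k else 0)" for k and a b :: bool
    by (induction k) auto
  \<comment> \<open>The constants for the two possible first letters are compared through the
    leftmost cap; one word with \<open>w\<close> ones behind it is enough.\<close>
  have shift: "Y True w = (Avar ^ 2) ^ (n - w) * Y False (Suc w)" if "w < n" for w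
  proof -
    let ?t = "replicate w True @ replicate (n - 1 - w) False"
    have t: "length ?t = n - 1" "ones ?t = w" "zeros ?t = n - 1 - w"
      using that by (simp_all add: count)
    have "f (False # True # ?t) = inverse (Avar ^ 2) * f (True # False # ?t)"
      using Suc.prems[of 0 ?t] t that by (simp add: cap_op_def)
    moreover have "f (False # True # ?t) = weight (True # ?t) * Y False (ones (True # ?t))"
        "f (True # False # ?t) = weight (False # ?t) * Y True (ones (False # ?t))"
      using t that by (intro Y; simp)+
    ultimately have "(Avar ^ 2) ^ (n - 1 - w) * weight ?t * Y False (Suc w)
        = inverse (Avar ^ 2) * (weight ?t * Y True w)"
      using t by auto
    moreover have "weight ?t \<noteq> 0" by (simp add: weight_def)
    ultimately have "(Avar ^ 2) ^ (n - 1 - w) * Y False (Suc w) = inverse (Avar ^ 2) * Y True w"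
      by (simp add: ac_simps)
    then have "Y True w = Avar ^ 2 * (Avar ^ 2) ^ (n - 1 - w) * Y False (Suc w)"
      by (simp add: field_simps)
    moreover have "n - w = Suc (n - 1 - w)" using that by simp
    ultimately show ?thesis by simp
  qed
  \<comment> \<open>The word consisting only of \<open>True\<close> has no counterpart starting with
    \<open>False\<close>, hence a separate constant.\<close>
  have "f s = weight s * (if ones s \<le> n then Y False (ones s) else Y True n)" if "length s = Suc n" for s
  proof -
    from that obtain a t where s: "s = a # t" and t: "length t = n" by (cases s) auto
    have zo: "zeros t + ones t = n" using zeros_plus_ones[of t] t by simp
    show ?thesis
    proof (cases a)
      case True
      show ?thesis
      proof (cases "ones t < n")
        case less: True
        have "zeros t = n - ones t" using zo by simp
        then show ?thesis using less True s Y[OF t, of a] shift[OF less] by simp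
      next
        case False
        then have "ones t = n" "zeros t = 0" using zo by auto
        then show ?thesis using True s Y[OF t, of a] by simp
      qed
    next
      case False
      then show ?thesis using s Y[OF t, of a] zo by simp
    qed
  qed
  then show ?case
    by (intro exI[of _ "\<lambda>w. if w \<le> n then Y False w else Y True n"]) blast
qed

lemma weight_sum_tl_subalgebra:
  "u \<in> tl_subalgebra n \<Longrightarrow> weight_sum n w (comb_op u f) = 0"
  unfolding tl_subalgebra_def
proof (induction u rule: comb.span_induct_alt)
  case (step c x y)
  then obtain "is" where x: "x = prod_list (map tl_gen is)" "is \<noteq> []" "\<forall>i\<in>set is. i + 1 < n" by blast
  \<comment> \<open>The last generator acts last and ends in a cup, which the pairing kills.\<close>
  then obtain js i where "is = js @ [i]" by (metis rev_exhaust)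
  with x have "weight_sum n w (comb_op x f) = 0"
    using weight_sum_slice_op_Cup[of i n] by (simp add: tl_gen_def)
  with step show ?case by (simp add: weight_sum_add weight_sum_scale)
qed simp

text \<open>The image is symmetric because every cap kills it, so only one scalar per number of ones
  is unknown. Pairing determines it, since \<open>f\<close> is \<open>1 + u\<close> and the pairing
  vanishes on the image of \<open>u\<close>.\<close>

lemma comb_op_is_jones_wenzl:
  assumes f: "is_jones_wenzl n f" and h: "supported n h" and s: "length s = n"
  shows "comb_op f h s = weight s * weight_sum n (ones s) h / weight_norm n (ones s)"
proof -
  let ?y = "comb_op f h"
  have "slice_op i Cap ?y s = 0" if "i \<le> length s" "length s + 2 = n" for i s
  proof -
    have "skein_eq n n (f * tl_gen i) 0"
      using f that by (simp add: is_jones_wenzl_def)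
    from comb_op_skein_eq[OF this h] have "slice_op i Cup (slice_op i Cap ?y) = (\<lambda>s. 0)"
      by (simp add: tl_gen_def)
    from slice_op_Cup_inject[OF this] show ?thesis using that by simp
  qed
  from symmetric_state[of n, OF this] obtain Y where Y: "\<And>s. length s = n \<Longrightarrow> ?y s = weight s * Y (ones s)"
    by auto
  obtain u where u: "u \<in> tl_subalgebra n" "skein_eq n n f (1 + u)"
    using f by (auto simp: is_jones_wenzl_def)
  have "weight_sum n w ?y = weight_sum n w h" for w
    using comb_op_skein_eq[OF u(2) h] weight_sum_tl_subalgebra[OF u(1)] by (simp add: weight_sum_add)
  moreover have "weight_sum n w ?y = Y w * weight_norm n w" for w
    unfolding weight_norm_def weight_sum_scale[symmetric]
    by (rule weight_sum_cong) (simp add: Y mult.commute)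
  moreover have "weight_norm n (ones s) \<noteq> 0"
    using zeros_plus_ones[of s] s by (intro weight_norm_nonzero) simp
  ultimately show ?thesis using Y[OF s] by (simp add: field_simps)
qed

lemma comb_op_jones_wenzl:
  assumes "length r = n"
  shows "comb_op (jones_wenzl n) h (r @ s) =
    weight r * weight_sum n (ones r) (\<lambda>t. h (t @ s)) / weight_norm n (ones r)"
proof -
  have "jones_wenzl n \<in> tangle_combs n n"
    using is_jones_wenzl_jones_wenzl by (simp add: is_jones_wenzl_def)
  from comb_op_cut[OF this assms] have "comb_op (jones_wenzl n) h (r @ s) = comb_op (jones_wenzl n) (cut n s h) r" .
  also have "\<dots> = weight r * weight_sum n (ones r) (cut n s h) / weight_norm n (ones r)"
    by (rule comb_op_is_jones_wenzl[OF is_jones_wenzl_jones_wenzl supported_cut assms])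
  also have "weight_sum n (ones r) (cut n s h) = weight_sum n (ones r) (\<lambda>t. h (t @ s))"
    by (rule weight_sum_cong) (simp add: cut_def)
  finally show ?thesis .
qed

section \<open>The irreducible module spanned by the weight vectors\<close>

definition weight_vector :: "nat \<Rightarrow> nat \<Rightarrow> state" where
  "weight_vector n w s = (if length s = n \<and> ones s = w then weight s else 0)"

text \<open>Of the two constants below, it only matters that they do not depend on the state and that the
  first does not vanish: \<open>weight_norm\<close> satisfies the same recursion in \<open>w\<close>.\<close>

definition raise_coeff :: "nat \<Rightarrow> nat \<Rightarrow> qA" where
  "raise_coeff n w = (Avar ^ 2) ^ Suc w / (Avar ^ 2) ^ n * (\<Sum>i\<le>w. (Avar ^ 4) ^ i)"

primrec lower_coeff :: "nat \<Rightarrow> qA" where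
  "lower_coeff 0 = 0"
| "lower_coeff (Suc j) = lower_coeff j / Avar ^ 2 + (Avar ^ 2) ^ j"

lemma raise_coeff_nonzero: "raise_coeff n w \<noteq> 0"
proof -
  have "(Avar ^ 4) ^ Suc w \<noteq> 1" "Avar ^ 4 \<noteq> 1"
    unfolding power_mult[symmetric] Avar_power_eq_1_iff by simp_all
  then have "(\<Sum>i<Suc w. (Avar ^ 4) ^ i) \<noteq> 0"
    by (simp only: sum_gp_strict) auto
  then show ?thesis
    unfolding raise_coeff_def lessThan_Suc_atMost by simp
qed

lemma raise_op_weight_vector:
  "raise_op (weight_vector n w) = (\<lambda>s. raise_coeff n w * weight_vector n (Suc w) s)"
proof
  fix s
  show "raise_op (weight_vector n w) s = raise_coeff n w * weight_vector n (Suc w) s"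
  proof (induction s arbitrary: n w)
    case (Cons a s)
    show ?case
    proof (cases n)
      case 0
      then have "(\<lambda>t. weight_vector n w (b # t)) = (\<lambda>t. 0)" for b
        by (simp add: weight_vector_def)
      then show ?thesis
        using 0 by (cases a) (simp_all add: raise_op_linear weight_vector_def)
    next
      case (Suc k)
      have F: "weight_vector n v (False # t) = weight_vector k v t" for v t
        by (simp add: weight_vector_def Suc)
      have coeff: "raise_coeff n v = inverse (Avar ^ 2) * raise_coeff k v" for v
        by (simp add: raise_coeff_def Suc field_simps)
      show ?thesis
      proof (cases a)
        case False
        then show ?thesis
          using Cons.IH[of k w] by (simp add: F coeff)
      next
        case True
        show ?thesis
        proof (cases w)
          case 0
          have T: "(\<lambda>t. weight_vector n w (True # t)) = (\<lambda>t. 0)"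
            by (simp add: weight_vector_def 0 fun_eq_iff)
          have z: "zeros s = k" if "length s = k" "ones s = 0"
            using zeros_plus_ones[of s] that by simp
          show ?thesis
            using True T z by (simp add: weight_vector_def 0 Suc raise_op_linear raise_coeff_def)
        next
          case w: (Suc v)
          have T: "(\<lambda>t. weight_vector n w (True # t)) = (\<lambda>t. (Avar ^ 2) ^ (k - v) * weight_vector k v t)"
          proof
            fix t
            have "zeros t = k - v" if "length t = k" "ones t = v"
              using zeros_plus_ones[of t] that by simp
            then show "weight_vector n w (True # t) = (Avar ^ 2) ^ (k - v) * weight_vector k v t"
              by (simp add: weight_vector_def w Suc)
          qed
          show ?thesis
          proof (cases "length s = k \<and> ones s = w")
            case len: True
            then have z: "zeros s + w = k" using zeros_plus_ones[of s] by simp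
            define d where "d = zeros s"
            have k: "k = Suc (v + d)" using z w d_def by simp
            define S where "S = (\<Sum>i\<le>v. (Avar ^ 4) ^ i)"
            have "Avar ^ 4 = Avar ^ 2 * Avar ^ 2" by (simp flip: power_add)
            \<comment> \<open>The summand \<open>1\<close> comes from raising the first letter, the
              rest from raising inside the tail.\<close>
            then have geo: "(\<Sum>i\<le>Suc v. (Avar ^ 4) ^ i) = 1 + Avar ^ 2 * Avar ^ 2 * S"
              unfolding S_def by (simp only: sum.atMost_Suc_shift sum_distrib_left power_Suc power_0)
            have "raise_op (weight_vector n w) (a # s)
                = weight s + Avar ^ 2 * ((Avar ^ 2) ^ Suc d * (raise_coeff k v * weight s))"
              using True T Cons.IH[of k v] len w
              by (simp add: raise_op_linear F k) (simp add: weight_vector_def k)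
            also have "\<dots> = raise_coeff n w * ((Avar ^ 2) ^ d * weight s)"
              unfolding raise_coeff_def w geo Suc k S_def[symmetric]
              by (simp add: power_add divide_simps) (simp add: algebra_simps)
            also have "\<dots> = raise_coeff n w * weight_vector n (Suc w) (a # s)"
              using len True by (simp add: weight_vector_def Suc d_def)
            finally show ?thesis .
          next
            case False
            then show ?thesis
              using True T Cons.IH[of k v] w
              by (auto simp: raise_op_linear weight_vector_def Suc)
          qed
        qed
      qed
    qed
  qed (simp add: weight_vector_def)
qed

text \<open>The transposed form of the previous fact: the pairings, too, are shifted by the raising
  operator up to constants.\<close>

lemma weight_sum_raise_op:
  "weight_sum n (Suc w) (raise_op f) = lower_coeff (n - w) * weight_sum n w f"
proof (induction n arbitrary: w f)
  case 0
  show ?case by (simp add: weight_sum_0)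
next
  case (Suc n)
  let ?F = "\<lambda>t. f (False # t)" and ?T = "\<lambda>t. f (True # t)"
  have *: "weight_sum (Suc n) (Suc w) (raise_op f) =
      inverse (Avar ^ 2) * (lower_coeff (n - w) * weight_sum n w ?F)
      + (Avar ^ 2) ^ (n - w) * (weight_sum n w ?F + Avar ^ 2 * weight_sum n w (raise_op ?T))"
    by (simp add: weight_sum_Suc weight_sum_scale weight_sum_add Suc)
  have rec: "inverse (Avar ^ 2) * (lower_coeff (n - w) * x) + (Avar ^ 2) ^ (n - w) * x
      = lower_coeff (Suc n - w) * x" if "w \<le> n" for x
    using that by (simp add: Suc_diff_le field_simps)
  show ?case
  proof (cases w)
    case 0
    \<comment> \<open>Raising creates a \<open>True\<close>, so a raised state vanishes at the word
      without ones.\<close>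
    have "weight_sum n 0 (raise_op g) = 0" for g
      by (induction n arbitrary: g) (simp_all add: weight_sum_0 weight_sum_Suc weight_sum_scale)
    then show ?thesis
      unfolding * using rec 0 by (simp add: weight_sum_Suc distrib_left)
  next
    case w: (Suc v)
    have T: "weight_sum n w (raise_op ?T) = lower_coeff (n - v) * weight_sum n v ?T"
      unfolding w by (rule Suc.IH)
    show ?thesis
    proof (cases "w \<le> n")
      case True
      then have "n - v = Suc (n - w)" "Suc n - w = n - v" using w by simp_all
      then show ?thesis
        unfolding * T distrib_left add.assoc[symmetric] rec[OF True]
        using w by (simp add: weight_sum_Suc algebra_simps)
    next
      \<comment> \<open>Here \<open>w = Suc v > n\<close>, so \<open>n - v\<close> and
        \<open>Suc n - w\<close> truncate to 0 and \<open>lower_coeff 0 = 0\<close> applies on both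
        sides.\<close>
      case False
      then show ?thesis
        unfolding * T using w weight_sum_large[of n w] by (simp add: weight_sum_Suc weight_sum_large)
    qed
  qed
qed

text \<open>Schur's lemma: the weight vectors span an irreducible module, so every tangle acts on it by a
  scalar after projection.\<close>

lemma weight_sum_comb_op_weight_vector:
  assumes "w \<le> n"
  shows "weight_sum n w (comb_op x (weight_vector n w))
       = weight_sum n 0 (comb_op x (weight_vector n 0)) * weight_norm n w"
  using assms
proof (induction w)
  case (Suc w)
  have step: "raise_coeff n w * weight_sum n (Suc w) (comb_op x (weight_vector n (Suc w)))
      = lower_coeff (n - w) * weight_sum n w (comb_op x (weight_vector n w))" for x
  proof -
    have "raise_coeff n w * weight_sum n (Suc w) (comb_op x (weight_vector n (Suc w)))
        = weight_sum n (Suc w) (comb_op x (raise_op (weight_vector n w)))"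
      by (simp add: raise_op_weight_vector linear_op_scale[OF linear_op_comb_op] weight_sum_scale)
    also have "\<dots> = lower_coeff (n - w) * weight_sum n w (comb_op x (weight_vector n w))"
      by (simp add: weight_sum_raise_op flip: raise_op_comb_op)
    finally show ?thesis .
  qed
  have norm: "weight_sum n w (weight_vector n w) = weight_norm n w" for w
    unfolding weight_norm_def by (rule weight_sum_cong) (simp add: weight_vector_def)
  \<comment> \<open>Taking the identity for \<open>x\<close> gives the recursion of the norms,
    against which the one for general \<open>x\<close> is compared.\<close>
  have "raise_coeff n w * weight_norm n (Suc w) = lower_coeff (n - w) * weight_norm n w"
    using step[of 1] by (simp add: norm)
  then have "raise_coeff n w * weight_sum n (Suc w) (comb_op x (weight_vector n (Suc w)))
     = raise_coeff n w * (weight_sum n 0 (comb_op x (weight_vector n 0)) * weight_norm n (Suc w))"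
    using step[of x] Suc by simp
  then show ?case
    using raise_coeff_nonzero by simp
qed simp


section \<open>Evaluation of the theta network\<close>

text \<open>Nested arcs join ends in reversed order and force opposite letters at the two ends; this
  is the word forced at the far ends.\<close>

definition dual :: "bool list \<Rightarrow> bool list" where
  "dual s = rev (map Not s)"

lemma dual_simps [simp]:
  "dual [] = []" "dual (a # s) = dual s @ [\<not> a]" "dual (s @ t) = dual t @ dual s"
  "dual (dual s) = s" "length (dual s) = length s"
  by (simp_all add: dual_def rev_map comp_def)

lemma count_dual [simp]: "zeros (dual s) = ones s" "ones (dual s) = zeros s"
  by (induction s) auto

text \<open>Reversal and negation together send a \<open>True\<close> before a \<open>False\<close>
  to another such pair.\<close>

lemma weight_dual [simp]: "weight (dual s) = weight s"
proof -
  have "inversions (dual s) = inversions s"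
    by (induction s) (simp_all add: inversions_append)
  then show ?thesis by (simp add: weight_def)
qed

lemma sum_bits_dual: "(\<Sum>s\<in>bits n. f (dual s)) = (\<Sum>s\<in>bits n. f s)"
  by (rule sum.reindex_bij_witness[of _ dual dual]) (auto simp: bits_def)

lemma slice_op_append:
  "length r = a \<Longrightarrow> slice_op (a + i) g f (r @ s) = slice_op i g (\<lambda>t. f (r @ t)) s"
  using comb_op_shift[of r a "of_word [(i, g)]" f s] by (simp add: shift_of_word)

lemma cups_Suc: "cups a (Suc p) = cups a p * of_word [(a + p, Cup)]"
  by (simp add: cups_def of_word_mult)

lemma caps_Suc: "caps a (Suc p) = of_word [(a + p, Cap)] * caps a p"
  by (simp add: caps_def of_word_mult)

text \<open>The cup added last is the innermost arc, joining the last letter of \<open>s\<close> to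
  the first of \<open>t\<close>. An arc costs \<open>- (Avar ^ 2)\<close> when its left end is
  \<open>False\<close> and nothing otherwise.\<close>

lemma comb_op_cups:
  "length x = a \<Longrightarrow> length s = p \<Longrightarrow> length t = p \<Longrightarrow>
     comb_op (cups a p) h (x @ s @ t @ y) = (if t = dual s then (- (Avar ^ 2)) ^ zeros s * h (x @ y) else 0)"
proof (induction p arbitrary: s t)
  case 0
  then show ?case by (simp add: cups_def)
next
  case (Suc p)
  obtain s' b where s: "s = s' @ [b]" "length s' = p"
    using Suc.prems(2) by (auto simp: length_Suc_conv_rev)
  obtain b' t' where t: "t = b' # t'" "length t' = p"
    using Suc.prems(3) by (auto simp: length_Suc_conv)
  let ?h = "comb_op (cups a p) h"
  have "comb_op (cups a (Suc p)) h (x @ s @ t @ y) = slice_op (a + p + 0) Cup ?h ((x @ s') @ b # b' # t' @ y)"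
    by (simp add: cups_Suc s t)
  also have "\<dots> = cup_op (\<lambda>r. ?h (x @ s' @ r)) (b # b' # t' @ y)"
    using Suc.prems(1) s(2) by (subst slice_op_append) simp_all
  also have "\<dots> = (if t = dual s then (- (Avar ^ 2)) ^ zeros s * h (x @ y) else 0)"
    using Suc.IH[OF Suc.prems(1) s(2) t(2)] by (auto simp: s t)
  finally show ?case .
qed

lemma comb_op_caps:
  "length x = a \<Longrightarrow>
     comb_op (caps a p) h (x @ y) = (\<Sum>s\<in>bits p. (- inverse (Avar ^ 2)) ^ ones s * h (x @ s @ dual s @ y))"
proof (induction p arbitrary: h)
  case 0
  then show ?case by (simp add: caps_def)
next
  case (Suc p)
  let ?c = "- inverse (Avar ^ 2)"
  have "comb_op (caps a (Suc p)) h (x @ y)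
      = (\<Sum>s\<in>bits p. ?c ^ ones s * slice_op (a + p + 0) Cap h ((x @ s) @ dual s @ y))"
    using Suc.IH[OF Suc.prems] by (simp add: caps_Suc)
  also have "\<dots> = (\<Sum>s\<in>bits p. ?c ^ ones s * cap_op (\<lambda>r. h (x @ s @ r)) (dual s @ y))"
  proof (rule sum.cong)
    fix s assume "s \<in> bits p"
    then have "length (x @ s) = a + p" using Suc.prems by (simp add: bits_def)
    then show "?c ^ ones s * slice_op (a + p + 0) Cap h ((x @ s) @ dual s @ y)
        = ?c ^ ones s * cap_op (\<lambda>r. h (x @ s @ r)) (dual s @ y)"
      by (subst slice_op_append) simp_all
  qed simp
  also have "\<dots> = (\<Sum>s\<in>bits (p + 1). ?c ^ ones s * h (x @ s @ dual s @ y))"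
    unfolding sum_bits_add by (rule sum.cong) (simp_all add: sum_bits_Suc cap_op_def algebra_simps)
  finally show ?case by simp
qed

lemma cups_add: "cups a p * cups (a + p) q = cups a (p + q)"
  by (induction q) (simp_all add: cups_Suc add.assoc flip: mult.assoc, simp add: cups_def)

lemma caps_add: "caps (a + p) q * caps a p = caps a (p + q)"
  by (induction q) (simp_all add: caps_Suc add.assoc mult.assoc, simp add: caps_def)

lemma shift_cups: "shift a (cups b p) = cups (a + b) p"
  by (simp add: cups_def shift_of_word comp_def add.assoc)

lemma shift_caps: "shift a (caps b p) = caps (a + b) p"
  by (simp add: caps_def shift_of_word comp_def add.assoc)

lemma cups_in_tangle_combs: "cups a p \<in> tangle_combs (a + b) (a + 2 * p + b)"
proof (induction p)
  case 0
  then show ?case by (simp add: cups_def tangle_combs_one)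
next
  case (Suc p)
  then show ?case
    unfolding cups_Suc by (rule tangle_combs_mult) simp
qed

lemma caps_in_tangle_combs: "caps a p \<in> tangle_combs (a + 2 * p + b) (a + b)"
proof (induction p)
  case 0
  then show ?case by (simp add: caps_def tangle_combs_one)
next
  case (Suc p)
  show ?case
    unfolding caps_Suc by (rule tangle_combs_mult[OF _ Suc]) simp
qed

text \<open>The part of the network that closes up the edge of index \<open>m + n\<close>, which lies outermost on
  the left.\<close>

definition theta_inner :: "nat \<Rightarrow> nat \<Rightarrow> nat \<Rightarrow> comb" where
  "theta_inner m n k = cups n k * (jones_wenzl (n + k) * shift (n + k) (jones_wenzl (m + k)) * caps n k)"

text \<open>The \<open>m\<close> outer and \<open>n\<close> inner arcs at the first edge form one
  nest of \<open>m + n\<close> arcs, so the edge of index \<open>m + n\<close> is closed up around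
  the rest of the network.\<close>

lemma theta_eq:
  "theta m n k = cups 0 (m + n)
     * (shift (m + n) (cups n k) * jones_wenzl (m + n)
        * shift (m + n) (jones_wenzl (n + k) * shift (n + k) (jones_wenzl (m + k)) * caps n k))
     * caps 0 (m + n)"
proof -
  have 1: "cups 0 m * cups m n = cups 0 (m + n)" and 2: "caps m n * caps 0 m = caps 0 (m + n)"
    using cups_add[of 0 m n] caps_add[of 0 m n] by simp_all
  have "theta m n k = (cups 0 m * cups m n) * (cups (m + 2 * n) k
     * (jones_wenzl (m + n) * shift (m + n) (jones_wenzl (n + k))
        * shift (m + 2 * n + k) (jones_wenzl (m + k)))
     * caps (m + 2 * n) k) * (caps m n * caps 0 m)"
    by (simp add: theta_def mult.assoc)
  then show ?thesis
    unfolding 1 2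
    by (simp add: shift_mult shift_cups shift_caps shift_shift mult.assoc mult_2 add.assoc)
qed

lemma jones_wenzl_in_tangle_combs: "jones_wenzl n \<in> tangle_combs n n"
  using is_jones_wenzl_jones_wenzl by (simp add: is_jones_wenzl_def)

lemma theta_in_tangle_combs: "theta m n k \<in> tangle_combs 0 0"
proof -
  let ?p = "m + n"
  have e2: "n + 2 * k + m = n + k + (k + m)" and e3: "n + 2 * k + m = n + k + (m + k)"
    by simp_all
  have e: "2 * ?p + 0 = ?p + (n + m)" by simp
  have c: "cups 0 ?p \<in> tangle_combs 0 (?p + (n + m))" "caps 0 ?p \<in> tangle_combs (?p + (n + m)) 0"
    using cups_in_tangle_combs[of 0 ?p 0] caps_in_tangle_combs[of 0 ?p 0]
    by (simp_all only: e add_0_left)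
  have J: "jones_wenzl (n + k) \<in> tangle_combs (n + 2 * k + m) (n + 2 * k + m)"
    unfolding e2 by (rule tangle_combs_add_right[OF jones_wenzl_in_tangle_combs])
  have J': "shift (n + k) (jones_wenzl (m + k)) \<in> tangle_combs (n + 2 * k + m) (n + 2 * k + m)"
    unfolding e3 by (rule shift_in_tangle_combs[OF jones_wenzl_in_tangle_combs])
  show ?thesis
    unfolding theta_eq
    by (intro tangle_combs_mult[OF tangle_combs_mult[OF c(1)] c(2)]
        tangle_combs_mult[OF tangle_combs_mult[OF shift_in_tangle_combs[OF cups_in_tangle_combs]
            tangle_combs_add_right[OF jones_wenzl_in_tangle_combs]]]
        shift_in_tangle_combs
        tangle_combs_mult[OF tangle_combs_mult[OF J J'] caps_in_tangle_combs])
qed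

text \<open>\<open>q\<close> labels strands on which \<open>T\<close> does not act, so summing over
  it commutes with \<open>T\<close>.\<close>

lemma weight_sum_linear_op:
  assumes "linear_op T"
  shows "weight_sum n w (\<lambda>q. T (f q) t) = T (\<lambda>s. weight_sum n w (\<lambda>q. f q s)) t"
proof -
  have *: "(if ones q = w then weight q * x else 0) = (if ones q = w then weight q else 0) * x" for q x
    by simp
  show ?thesis
    unfolding weight_sum_def * by (simp add: linear_op_sum[OF assms])
qed

lemma sum_bits_weight: "(\<Sum>s\<in>bits n. weight s * f (ones s) s) = (\<Sum>w\<le>n. weight_sum n w (f w))"
proof -
  have "(\<Sum>w\<le>n. weight_sum n w (f w))
      = (\<Sum>s\<in>bits n. \<Sum>w\<le>n. if ones s = w then weight s * f w s else 0)"
    unfolding weight_sum_def by (rule sum.swap)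
  also have "\<dots> = (\<Sum>s\<in>bits n. weight s * f (ones s) s)"
  proof (rule sum.cong)
    fix s assume "s \<in> bits n"
    then show "(\<Sum>w\<le>n. if ones s = w then weight s * f w s else 0) = weight s * f (ones s) s"
      using ones_le_length[of s] by (simp add: bits_def)
  qed simp
  finally show ?thesis by simp
qed

lemma comb_op_nested_cups:
  "length q = p \<Longrightarrow> comb_op (cups 0 p) vacuum (q @ t) = (if t = dual q then (- (Avar ^ 2)) ^ zeros q else 0)"
proof (cases "length t = p")
  case True
  assume "length q = p"
  then show ?thesis using True comb_op_cups[of "[]" 0 q p t vacuum "[]"] by (simp add: vacuum_def)
next
  case False
  assume q: "length q = p"
  have "supported (0 + 2 * p + 0) (comb_op (cups 0 p) vacuum)"
    using cups_in_tangle_combs[of 0 p 0] by (intro supported_comb_op[OF supported_vacuum]) simp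
  then show ?thesis using False q by (auto simp: supported_def)
qed

text \<open>Nested arcs bend a pairing into a vector: \<open>dual\<close> keeps the weight and turns
  \<open>w\<close> ones into \<open>p - w\<close>.\<close>

lemma weight_sum_nested_cups:
  assumes "w \<le> p"
  shows "weight_sum p w (\<lambda>q. comb_op (cups 0 p) vacuum (q @ t))
       = (- (Avar ^ 2)) ^ (p - w) * weight_vector p (p - w) t"
proof -
  have "weight_sum p w (\<lambda>q. comb_op (cups 0 p) vacuum (q @ t))
      = (\<Sum>q\<in>bits p. if q = dual t then (if ones q = w then weight q * (- (Avar ^ 2)) ^ zeros q else 0) else 0)"
    unfolding weight_sum_def
    by (rule sum.cong) (auto simp: bits_def comb_op_nested_cups)
  also have "\<dots> = (- (Avar ^ 2)) ^ (p - w) * weight_vector p (p - w) t"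
    using zeros_plus_ones[of t] assms
    by (subst sum.delta[OF finite_bits]) (auto simp: bits_def weight_vector_def)
  finally show ?thesis .
qed

text \<open>The quantum dimension, one term per weight: a geometric series with ratio
  \<open>Avar ^ 4\<close>.\<close>

lemma Delta_eq_sum: "(\<Sum>w\<le>p. (- inverse (Avar ^ 2)) ^ (p - w) * (- (Avar ^ 2)) ^ w) = Delta (int p)"
proof -
  have A: "Avar ^ 4 \<noteq> 1" by (simp add: Avar_power_eq_1_iff)
  have A4: "Avar ^ 4 = Avar ^ 2 * Avar ^ 2" by (simp flip: power_add)
  have "(\<Sum>w\<le>p. (- inverse (Avar ^ 2)) ^ (p - w) * (- (Avar ^ 2)) ^ w)
      = (\<Sum>w\<le>p. (- inverse (Avar ^ 2)) ^ p * (Avar ^ 4) ^ w)"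
  proof (rule sum.cong)
    fix w assume "w \<in> {..p}"
    then obtain d where p: "p = d + w" by (auto simp: le_iff_add add.commute)
    have "(- inverse (Avar ^ 2)) ^ w * (Avar ^ 4) ^ w = (- (Avar ^ 2)) ^ w"
    proof -
      have "- inverse (Avar ^ 2) * Avar ^ 4 = - (Avar ^ 2)"
        unfolding A4 mult.assoc[symmetric] by simp
      then show ?thesis by (simp only: power_mult_distrib[symmetric])
    qed
    then show "(- inverse (Avar ^ 2)) ^ (p - w) * (- (Avar ^ 2)) ^ w = (- inverse (Avar ^ 2)) ^ p * (Avar ^ 4) ^ w"
      by (simp add: p power_add mult.assoc)
  qed simp
  also have "\<dots> = (- inverse (Avar ^ 2)) ^ p * ((1 - (Avar ^ 4) ^ Suc p) / (1 - Avar ^ 4))"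
    using A by (simp only: sum_distrib_left[symmetric] lessThan_Suc_atMost[symmetric] sum_gp_strict if_False)
  also have "(- inverse (Avar ^ 2)) ^ p = (-1) ^ p * inverse (Avar ^ 2) ^ p"
    by (rule power_minus)
  finally show ?thesis by (simp add: Delta_of_nat)
qed

text \<open>The idempotent turns the nest of arcs into weight vectors fed to
  \<open>theta_inner\<close>. By Schur's lemma each weight returns the same scalar times
  \<open>weight_norm\<close>, which cancels the denominator; the arcs contribute the terms of the
  quantum dimension.\<close>

lemma comb_op_theta:
  "comb_op (theta m n k) vacuum [] =
     weight_sum (m + n) 0 (comb_op (theta_inner m n k) (weight_vector (m + n) 0)) * Delta (int (m + n))"
proof -
  define p where "p = m + n"
  define Y where "Y = cups n k"
  define H where "H = jones_wenzl (n + k) * shift (n + k) (jones_wenzl (m + k)) * caps n k"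
  let ?C = "comb_op (cups 0 p) vacuum" and ?G = "theta_inner m n k"
  let ?u = "- (Avar ^ 2)" and ?v = "- inverse (Avar ^ 2)"
  have G: "comb_op ?G f = comb_op H (comb_op Y f)" for f
    by (simp add: theta_inner_def Y_def H_def)
  define F where "F r = ?v ^ ones r * (weight r / weight_norm p (ones r) *
      (?u ^ (p - ones r) * comb_op ?G (weight_vector p (p - ones r)) (dual r)))" for r
  define K where "K w r = ?v ^ (p - w) * ?u ^ w / weight_norm p w * comb_op ?G (weight_vector p w) r" for w r
  have "comb_op (theta m n k) vacuum [] = (\<Sum>r\<in>bits p. ?v ^ ones r *
      comb_op (shift p Y * jones_wenzl p * shift p H) ?C (r @ dual r))"
    unfolding theta_eq p_def[symmetric] Y_def[symmetric] H_def[symmetric]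
    using comb_op_caps[of "[]" 0 p _ "[]"] by simp
  also have "\<dots> = (\<Sum>r\<in>bits p. F r)"
  proof (rule sum.cong)
    fix r assume "r \<in> bits p"
    then have r: "length r = p" by (simp add: bits_def)
    have le: "ones r \<le> p" using ones_le_length[of r] r by simp
    have "comb_op (jones_wenzl p) (comb_op (shift p Y) ?C) (r @ t)
        = weight r / weight_norm p (ones r) * (?u ^ (p - ones r) * comb_op Y (weight_vector p (p - ones r)) t)" for t
    proof -
      have "comb_op (jones_wenzl p) (comb_op (shift p Y) ?C) (r @ t)
          = weight r / weight_norm p (ones r) * weight_sum p (ones r) (\<lambda>q. comb_op (shift p Y) ?C (q @ t))"
        by (simp add: comb_op_jones_wenzl[OF r])
      also have "weight_sum p (ones r) (\<lambda>q. comb_op (shift p Y) ?C (q @ t))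
          = weight_sum p (ones r) (\<lambda>q. comb_op Y (\<lambda>s. ?C (q @ s)) t)"
        by (rule weight_sum_cong) (simp add: comb_op_shift)
      also have "\<dots> = comb_op Y (\<lambda>s. weight_sum p (ones r) (\<lambda>q. ?C (q @ s))) t"
        by (rule weight_sum_linear_op[OF linear_op_comb_op])
      also have "\<dots> = ?u ^ (p - ones r) * comb_op Y (weight_vector p (p - ones r)) t"
        by (simp only: weight_sum_nested_cups[OF le] linear_op_scale[OF linear_op_comb_op])
      finally show ?thesis .
    qed
    then show "?v ^ ones r * comb_op (shift p Y * jones_wenzl p * shift p H) ?C (r @ dual r) = F r"
      by (simp only: comb_op_mult comb_op_shift[OF r] linear_op_scale[OF linear_op_comb_op] G F_def)
  qed simp
  \<comment> \<open>Summing over the right ends of the closing arcs makes the output word of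
    \<open>theta_inner\<close> the summation variable.\<close>
  also have "\<dots> = (\<Sum>r\<in>bits p. F (dual r))"
    by (rule sum_bits_dual[of F, symmetric])
  also have "\<dots> = (\<Sum>r\<in>bits p. weight r * K (ones r) r)"
  proof (rule sum.cong)
    fix r assume "r \<in> bits p"
    then have "zeros r = p - ones r" "ones r \<le> p"
      using zeros_plus_ones[of r] by (auto simp: bits_def)
    then show "F (dual r) = weight r * K (ones r) r"
      by (simp add: F_def K_def weight_norm_symmetric)
  qed simp
  also have "\<dots> = (\<Sum>w\<le>p. weight_sum p w (K w))"
    by (rule sum_bits_weight)
  also have "\<dots> = (\<Sum>w\<le>p. weight_sum p 0 (comb_op ?G (weight_vector p 0)) * (?v ^ (p - w) * ?u ^ w))"
  proof (rule sum.cong)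
    fix w assume "w \<in> {..p}"
    then have w: "w \<le> p" by simp
    have "weight_sum p w (K w) = ?v ^ (p - w) * ?u ^ w / weight_norm p w *
        (weight_sum p 0 (comb_op ?G (weight_vector p 0)) * weight_norm p w)"
      unfolding K_def weight_sum_scale weight_sum_comb_op_weight_vector[OF w] ..
    then show "weight_sum p w (K w) = weight_sum p 0 (comb_op ?G (weight_vector p 0)) * (?v ^ (p - w) * ?u ^ w)"
      using weight_norm_nonzero[OF w] by simp
  qed simp
  also have "\<dots> = weight_sum p 0 (comb_op ?G (weight_vector p 0)) * Delta (int p)"
    by (simp only: sum_distrib_left[symmetric] Delta_eq_sum)
  finally show ?thesis by (simp add: p_def)
qed

section \<open>The scalar at the extremal weight\<close>

lemma inversions_replicate_False [simp]: "inversions (replicate n False) = 0"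
  by (induction n) simp_all

lemma count_replicate_False [simp]: "ones (replicate n False) = 0" "zeros (replicate n False) = n"
  by (induction n) simp_all

lemma weight_replicate_False:
  "weight (replicate n False @ s) = weight s"
  "weight (s @ replicate n False) = weight s * (Avar ^ 2) ^ (ones s * n)"
  by (simp_all add: weight_def inversions_append power_add)

lemma weight_sum_prefix:
  assumes "\<And>r s. length r = n \<Longrightarrow> r \<noteq> replicate n False \<Longrightarrow> f (r @ s) = 0"
  shows "weight_sum (n + k) w f = weight_sum k w (\<lambda>s. f (replicate n False @ s))"
proof -
  have "weight_sum (n + k) w f = (\<Sum>r\<in>bits n. \<Sum>s\<in>bits k.
      if ones (r @ s) = w then weight (r @ s) * f (r @ s) else 0)"
    unfolding weight_sum_def by (rule sum_bits_add)
  also have "\<dots> = (\<Sum>r\<in>bits n. if r = replicate n False then weight_sum k w (\<lambda>s. f (replicate n False @ s)) else 0)"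
  proof (rule sum.cong)
    fix r assume "r \<in> bits n"
    then show "(\<Sum>s\<in>bits k. if ones (r @ s) = w then weight (r @ s) * f (r @ s) else 0)
        = (if r = replicate n False then weight_sum k w (\<lambda>s. f (replicate n False @ s)) else 0)"
      by (cases "r = replicate n False")
        (simp_all add: assms bits_def weight_sum_def weight_replicate_False cong: if_cong)
  qed simp
  also have "\<dots> = weight_sum k w (\<lambda>s. f (replicate n False @ s))"
    by (subst sum.delta[OF finite_bits]) (simp add: bits_def)
  finally show ?thesis .
qed

text \<open>Unlike leading zeros, trailing zeros count: each of them is inverted with each of the
  \<open>w\<close> ones.\<close>

lemma weight_sum_suffix:
  assumes "\<And>s r. length s = k \<Longrightarrow> length r = m \<Longrightarrow> r \<noteq> replicate m False \<Longrightarrow> f (s @ r) = 0"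
  shows "weight_sum (k + m) w f = (Avar ^ 2) ^ (w * m) * weight_sum k w (\<lambda>s. f (s @ replicate m False))"
proof -
  have "weight_sum (k + m) w f = (\<Sum>s\<in>bits k. \<Sum>r\<in>bits m.
      if ones (s @ r) = w then weight (s @ r) * f (s @ r) else 0)"
    unfolding weight_sum_def by (rule sum_bits_add)
  also have "\<dots> = (\<Sum>s\<in>bits k. \<Sum>r\<in>bits m. if r = replicate m False then
      (if ones s = w then weight (s @ replicate m False) * f (s @ replicate m False) else 0) else 0)"
    using assms by (intro sum.cong) (auto simp: bits_def)
  also have "\<dots> = (\<Sum>s\<in>bits k. if ones s = w then weight (s @ replicate m False) * f (s @ replicate m False) else 0)"
    by (intro sum.cong refl, subst sum.delta[OF finite_bits]) (simp add: bits_def)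
  also have "\<dots> = (Avar ^ 2) ^ (w * m) * weight_sum k w (\<lambda>s. f (s @ replicate m False))"
    unfolding weight_sum_def sum_distrib_left
    by (intro sum.cong) (auto simp: weight_replicate_False)
  finally show ?thesis .
qed

lemma weight_vector_0: "weight_vector p 0 s = (if s = replicate p False then 1 else 0)"
proof -
  have "s = replicate (length s) False" if "ones s = 0"
    using that
  proof (induction s)
    case (Cons a s)
    then show ?case by (cases a) auto
  qed simp
  then have "length s = p \<and> ones s = 0 \<longleftrightarrow> s = replicate p False"
    by auto
  then show ?thesis
    by (auto simp: weight_vector_def weight_replicate_False(1)[of p "[]", simplified])
qed

lemma weight_sum_0_right: "weight_sum n 0 f = f (replicate n False)"
  by (induction n arbitrary: f) (simp_all add: weight_sum_0 weight_sum_Suc)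

text \<open>The extremal vector forces \<open>False\<close> on the \<open>n\<close> strands to the
  left and the \<open>m\<close> strands to the right. Only the \<open>k\<close> arcs are free:
  \<open>c\<close> ones at their left ends mean \<open>k - c\<close> at their right ends.\<close>

lemma theta_inner_weight_sum:
  assumes "c \<le> k"
  shows "weight_sum (k + m) (k - c) (\<lambda>t. weight_sum (n + k) c
           (\<lambda>q. comb_op (cups n k) (weight_vector (m + n) 0) (q @ t)))
       = (Avar ^ 2) ^ ((k - c) * m) * ((- (Avar ^ 2)) ^ (k - c) * weight_norm k c)"
proof -
  let ?h = "comb_op (cups n k) (weight_vector (m + n) 0)"
  have h: "?h (q1 @ q2 @ t1 @ t2) = (if t1 = dual q2 then (- (Avar ^ 2)) ^ zeros q2 else 0) *
      (if q1 = replicate n False \<and> t2 = replicate m False then 1 else 0)"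
    if "length q1 = n" "length q2 = k" "length t1 = k" "length t2 = m" for q1 q2 t1 t2
  proof -
    have "q1 @ t2 = replicate (m + n) False \<longleftrightarrow> q1 = replicate n False \<and> t2 = replicate m False"
      using that by (simp add: replicate_add add.commute[of m n])
    then show ?thesis
      using comb_op_cups[OF that(1-3), of _ t2] by (simp add: weight_vector_0)
  qed
  have "weight_sum (k + m) (k - c) (\<lambda>t. weight_sum (n + k) c (\<lambda>q. ?h (q @ t)))
      = weight_sum (k + m) (k - c) (\<lambda>t. if drop k t = replicate m False then
          weight_sum k c (\<lambda>q. if take k t = dual q then (- (Avar ^ 2)) ^ zeros q else 0) else 0)"
  proof (rule weight_sum_cong)
    fix t :: "bool list" assume t: "length t = k + m"
    define t1 where "t1 = take k t"
    define t2 where "t2 = drop k t"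
    have t12: "t = t1 @ t2" "length t1 = k" "length t2 = m"
      using t by (simp_all add: t1_def t2_def)
    have "weight_sum (n + k) c (\<lambda>q. ?h (q @ t)) = weight_sum (n + k) c
        (\<lambda>q. if take n q = replicate n False \<and> t2 = replicate m False then
          (if t1 = dual (drop n q) then (- (Avar ^ 2)) ^ zeros (drop n q) else 0) else 0)"
    proof (rule weight_sum_cong)
      fix q :: "bool list" assume "length q = n + k"
      then show "?h (q @ t) = (if take n q = replicate n False \<and> t2 = replicate m False then
          (if t1 = dual (drop n q) then (- (Avar ^ 2)) ^ zeros (drop n q) else 0) else 0)"
        using h[of "take n q" "drop n q" t1 t2] t12 by (simp flip: append_assoc)
    qed
    also have "\<dots> = weight_sum k c (\<lambda>q. if t2 = replicate m False then
          (if t1 = dual q then (- (Avar ^ 2)) ^ zeros q else 0) else 0)"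
      by (subst weight_sum_prefix) (simp_all cong: if_cong)
    also have "\<dots> = (if t2 = replicate m False then
          weight_sum k c (\<lambda>q. if t1 = dual q then (- (Avar ^ 2)) ^ zeros q else 0) else 0)"
      by simp
    finally show "weight_sum (n + k) c (\<lambda>q. ?h (q @ t)) = (if drop k t = replicate m False then
          weight_sum k c (\<lambda>q. if take k t = dual q then (- (Avar ^ 2)) ^ zeros q else 0) else 0)"
      by (simp add: t1_def t2_def)
  qed
  also have "\<dots> = (Avar ^ 2) ^ ((k - c) * m) * weight_sum k (k - c) (\<lambda>t.
      if drop k (t @ replicate m False) = replicate m False then weight_sum k c
        (\<lambda>q. if take k (t @ replicate m False) = dual q then (- (Avar ^ 2)) ^ zeros q else 0) else 0)"
    by (rule weight_sum_suffix) (auto simp: weight_sum_def)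
  also have "weight_sum k (k - c) (\<lambda>t. if drop k (t @ replicate m False) = replicate m False then
      weight_sum k c (\<lambda>q. if take k (t @ replicate m False) = dual q then (- (Avar ^ 2)) ^ zeros q else 0) else 0)
      = weight_sum k (k - c) (\<lambda>t. (- (Avar ^ 2)) ^ (k - c) * weight t)"
  proof (rule weight_sum_cong)
    fix t :: "bool list" assume t: "length t = k" "ones t = k - c"
    have z: "zeros t = c" using zeros_plus_ones[of t] t assms by simp
    have "weight_sum k c (\<lambda>q. if t = dual q then (- (Avar ^ 2)) ^ zeros q else 0)
        = (\<Sum>q\<in>bits k. if q = dual t then (if ones q = c then weight q * (- (Avar ^ 2)) ^ zeros q else 0) else 0)"
      unfolding weight_sum_def by (rule sum.cong) auto
    also have "\<dots> = (- (Avar ^ 2)) ^ (k - c) * weight t"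
      using t z by (subst sum.delta[OF finite_bits]) (simp add: bits_def)
    finally show "(if drop k (t @ replicate m False) = replicate m False then weight_sum k c
        (\<lambda>q. if take k (t @ replicate m False) = dual q then (- (Avar ^ 2)) ^ zeros q else 0) else 0)
      = (- (Avar ^ 2)) ^ (k - c) * weight t"
      using t by simp
  qed
  also have "\<dots> = (- (Avar ^ 2)) ^ (k - c) * weight_norm k c"
    using assms by (simp add: weight_sum_scale weight_norm_symmetric flip: weight_norm_def)
  finally show ?thesis .
qed

text \<open>\<open>c\<close> counts the ones at the left ends of the \<open>k\<close> arcs. One
  factor \<open>weight_norm k c\<close> comes from the lower arcs and one from the upper; the
  \<open>m\<close> trailing zeros contribute \<open>(Avar ^ 2) ^ ((k - c) * m)\<close> on either
  side of the idempotent of index \<open>m + k\<close>.\<close>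

lemma theta_inner_vacuum:
  "weight_sum (m + n) 0 (comb_op (theta_inner m n k) (weight_vector (m + n) 0)) =
     (\<Sum>c\<le>k. (- inverse (Avar ^ 2)) ^ c * (- (Avar ^ 2)) ^ (k - c) * (Avar ^ 4) ^ ((k - c) * m)
        * weight_norm k c ^ 2 / (weight_norm (m + k) (k - c) * weight_norm (n + k) c))"
proof -
  let ?h = "comb_op (cups n k) (weight_vector (m + n) 0)"
  let ?F = "replicate n False" and ?F' = "replicate m False"
  let ?u = "- (Avar ^ 2)" and ?v = "- inverse (Avar ^ 2)"
  define X where "X c = ?v ^ c * ?u ^ (k - c) * (Avar ^ 4) ^ ((k - c) * m)
        * weight_norm k c / (weight_norm (m + k) (k - c) * weight_norm (n + k) c)" for c
  have A: "(Avar ^ 2) ^ a * (Avar ^ 2) ^ a = (Avar ^ 4) ^ a" for a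
    by (simp flip: power_mult power_add)
  have "weight_sum (m + n) 0 (comb_op (theta_inner m n k) (weight_vector (m + n) 0))
     = (\<Sum>s\<in>bits k. ?v ^ ones s *
         comb_op (shift (n + k) (jones_wenzl (m + k))) (comb_op (jones_wenzl (n + k)) ?h) (?F @ s @ dual s @ ?F'))"
    using comb_op_caps[of ?F n k _ ?F']
    by (simp add: weight_sum_0_right theta_inner_def replicate_add add.commute[of m n])
  also have "\<dots> = (\<Sum>s\<in>bits k. weight s * (X (ones s) * weight s))"
  proof (rule sum.cong)
    fix s assume "s \<in> bits k"
    then have s: "length s = k" by (simp add: bits_def)
    define c where "c = ones s"
    have c: "c \<le> k" "zeros s = k - c"
      using zeros_plus_ones[of s] s by (simp_all add: c_def)
    have x: "length (?F @ s) = n + k" and y: "length (dual s @ ?F') = m + k"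
      using s by simp_all
    have "comb_op (shift (n + k) (jones_wenzl (m + k))) (comb_op (jones_wenzl (n + k)) ?h) (?F @ s @ dual s @ ?F')
        = comb_op (jones_wenzl (m + k)) (\<lambda>t. comb_op (jones_wenzl (n + k)) ?h ((?F @ s) @ t)) ((dual s @ ?F') @ [])"
      using comb_op_shift[OF x, of _ _ "dual s @ ?F'"] by simp
    also have "\<dots> = weight (dual s @ ?F') * weight_sum (m + k) (k - c) (\<lambda>t. comb_op (jones_wenzl (n + k)) ?h ((?F @ s) @ t))
         / weight_norm (m + k) (k - c)"
      by (subst comb_op_jones_wenzl[OF y]) (simp add: c)
    also have "(\<lambda>t. comb_op (jones_wenzl (n + k)) ?h ((?F @ s) @ t))
        = (\<lambda>t. weight s / weight_norm (n + k) c * weight_sum (n + k) c (\<lambda>q. ?h (q @ t)))"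
      by (simp only: comb_op_jones_wenzl[OF x]) (simp add: weight_replicate_False c_def)
    also have "weight_sum (m + k) (k - c) \<dots> = weight s / weight_norm (n + k) c *
        ((Avar ^ 2) ^ ((k - c) * m) * (?u ^ (k - c) * weight_norm k c))"
      by (simp only: weight_sum_scale add.commute[of m k] theta_inner_weight_sum[OF c(1)])
    also have "weight (dual s @ ?F') = weight s * (Avar ^ 2) ^ ((k - c) * m)"
      by (simp add: weight_replicate_False c)
    finally show "?v ^ ones s * comb_op (shift (n + k) (jones_wenzl (m + k)))
        (comb_op (jones_wenzl (n + k)) ?h) (?F @ s @ dual s @ ?F') = weight s * (X (ones s) * weight s)"
      unfolding c_def[symmetric] X_def A[symmetric] by (simp add: ac_simps)
  qed simp
  also have "\<dots> = (\<Sum>c\<le>k. weight_sum k c (\<lambda>s. X c * weight s))"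
    by (rule sum_bits_weight)
  also have "\<dots> = (\<Sum>c\<le>k. X c * weight_norm k c)"
    by (simp add: weight_sum_scale weight_norm_def)
  finally show ?thesis
    by (simp add: X_def power2_eq_square mult.assoc)
qed

section \<open>The q-Vandermonde identity and the closed forms\<close>

definition gauss :: "nat \<Rightarrow> nat \<Rightarrow> qA" where
  "gauss n j = q_binomial (Avar ^ 4) (n + j) j"

lemma gauss_0 [simp]: "gauss n 0 = 1" "gauss 0 j = 1"
  by (simp_all add: gauss_def q_binomial_def q_pochhammer_nonzero) (simp_all add: q_pochhammer_def)

lemma gauss_Suc: "gauss (Suc n) (Suc j) = gauss (Suc n) j + (Avar ^ 4) ^ Suc j * gauss n (Suc j)"
proof -
  let ?q = "Avar ^ 4"
  let ?p = "q_pochhammer ?q ?q"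
  define P where "P = ?p (Suc (n + j))"
  have 1: "1 - Avar ^ 4 * (Avar ^ 4) ^ j \<noteq> 0" for j
    using q_pochhammer_nonzero[of "Suc j"] by (simp add: q_pochhammer_Suc)
  have pn: "?p (Suc (Suc (n + j))) = P * (1 - ?q ^ Suc n * ?q ^ Suc j)"
    unfolding q_pochhammer_Suc[of _ "Suc (n + j)"] P_def power_add[symmetric] by simp
  have "?p (Suc (Suc (n + j))) / (?p (Suc j) * ?p (Suc n))
      = P / (?p j * ?p (Suc n)) + ?q ^ Suc j * (P / (?p (Suc j) * ?p n))"
    using q_pochhammer_nonzero[of n] q_pochhammer_nonzero[of j] 1[of n] 1[of j]
    unfolding pn q_pochhammer_Suc[of _ n] q_pochhammer_Suc[of _ j]
    by (simp add: divide_simps) (simp add: algebra_simps)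
  then show ?thesis by (simp add: gauss_def q_binomial_def P_def)
qed

text \<open>With q = \<open>Avar ^ 4\<close>, \<open>gauss n j\<close> is the coefficient of z^j in
  the reciprocal of (1 - z)(1 - q z)...(1 - q^n z). The identity splits the product for
  \<open>Suc (n + m)\<close> into its first m + 1 factors and the other n + 1, in which z is
  replaced by q^(m+1) z.\<close>

lemma gauss_vandermonde:
  "(\<Sum>j\<le>k. (Avar ^ 4) ^ (Suc m * j) * gauss n j * gauss m (k - j)) = gauss (Suc (n + m)) k"
proof (induction m arbitrary: k)
  case 0
  have "(\<Sum>j\<le>k. (Avar ^ 4) ^ j * gauss n j) = gauss (Suc n) k"
  proof (induction k)
    case (Suc k)
    then show ?case unfolding sum.atMost_Suc gauss_Suc by (simp only:)
  qed simp
  then show ?case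
    by (simp only: gauss_0 mult_1_right mult_Suc mult_0 add_0_right)
next
  case (Suc m)
  note IH = Suc.IH
  show ?case
  proof (induction k)
    case (Suc k)
    let ?q = "Avar ^ 4"
    \<comment> \<open>Applying \<open>gauss_Suc\<close> to the last factor gives two sums; in the
      second one the powers of \<open>?q\<close> combine so that \<open>?q ^ Suc k\<close> no longer
      depends on \<open>j\<close>.\<close>
    define f where "f j = ?q ^ (Suc (Suc m) * j) * gauss n j * gauss (Suc m) (k - j)" for j
    define h where "h j = ?q ^ (Suc m * j) * gauss n j * gauss m (Suc k - j)" for j
    have step: "?q ^ (Suc (Suc m) * j) * gauss n j * gauss (Suc m) (Suc k - j) = f j + ?q ^ Suc k * h j"
      if le: "j \<le> k" for j
    proof -
      obtain d where k: "k = j + d" using le_Suc_ex[OF le] ..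
      then have d: "k - j = d" "Suc k - j = Suc d" by simp_all
      have "?q ^ (Suc (Suc m) * j) * ?q ^ Suc d = ?q ^ Suc k * ?q ^ (Suc m * j)"
      proof -
        have "Suc (Suc m) * j + Suc d = Suc k + Suc m * j" using k by simp
        then show ?thesis unfolding power_add[symmetric] by (rule arg_cong)
      qed
      from arg_cong[OF this, of "\<lambda>x. x * (gauss n j * gauss m (Suc d))"]
      show ?thesis
        unfolding f_def h_def d gauss_Suc distrib_left by (simp only: ac_simps)
    qed
    \<comment> \<open>At \<open>j = Suc k\<close> the last factor is \<open>1\<close>, so
      \<open>gauss_Suc\<close> does not apply; the term belongs to the second sum.\<close>
    have last: "?q ^ (Suc (Suc m) * Suc k) * gauss n (Suc k) * gauss (Suc m) (Suc k - Suc k)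
        = ?q ^ Suc k * h (Suc k)"
      unfolding h_def diff_self_eq_0 gauss_0 mult_1_right mult.assoc[symmetric] power_add[symmetric]
      by (simp only: mult_Suc)
    have "(\<Sum>j\<le>Suc k. ?q ^ (Suc (Suc m) * j) * gauss n j * gauss (Suc m) (Suc k - j))
        = (\<Sum>j\<le>k. f j + ?q ^ Suc k * h j) + ?q ^ Suc k * h (Suc k)"
      unfolding sum.atMost_Suc last
      by (rule arg_cong2[where f = "(+)", OF sum.cong[OF refl step] refl]) simp
    also have "\<dots> = sum f {..k} + ?q ^ Suc k * sum h {..Suc k}"
      by (simp only: sum.distrib sum_distrib_left sum.atMost_Suc distrib_left add.assoc)
    also have "\<dots> = gauss (Suc (n + Suc m)) k + ?q ^ Suc k * gauss (Suc (n + m)) (Suc k)"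
      unfolding f_def h_def Suc IH ..
    also have "\<dots> = gauss (Suc (n + Suc m)) (Suc k)"
      by (simp only: gauss_Suc add_Suc_right)
    finally show ?case .
  qed simp
qed

text \<open>In each summand the squared norm and the two denominators regroup into
  \<open>gauss n j * gauss m (k - j)\<close> times a factor free of \<open>j\<close>.\<close>

lemma theta_inner_value:
  fixes m n k :: nat
  defines "p \<equiv> q_pochhammer (Avar ^ 4) (Avar ^ 4)"
  shows "weight_sum (m + n) 0 (comb_op (theta_inner m n k) (weight_vector (m + n) 0)) =
    (- inverse (Avar ^ 2)) ^ k * (p k * p m * p n * p (Suc (m + n + k)) / (p (m + k) * p (n + k) * p (Suc (m + n))))"
proof -
  let ?u = "- (Avar ^ 2)" and ?v = "- inverse (Avar ^ 2)" and ?q = "Avar ^ 4"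
  have nz: "p j \<noteq> 0" for j
    by (simp add: p_def q_pochhammer_nonzero)
  have vq: "?v * ?q = ?u"
  proof -
    have "?q = Avar ^ 2 * Avar ^ 2" by (simp flip: power_add)
    then show ?thesis by (simp only: mult.assoc[symmetric]) simp
  qed
  have norm: "weight_norm (a + b) a = p (a + b) / (p a * p b)" "gauss a b = p (a + b) / (p b * p a)" for a b
    by (simp_all add: weight_norm_eq gauss_def q_binomial_def p_def)
  have "(\<Sum>c\<le>k. ?v ^ c * ?u ^ (k - c) * ?q ^ ((k - c) * m) * weight_norm k c ^ 2
          / (weight_norm (m + k) (k - c) * weight_norm (n + k) c))
      = (\<Sum>c\<le>k. ?v ^ c * ?u ^ (k - c) * ?q ^ ((k - c) * m) * weight_norm k (k - c) ^ 2
          / (weight_norm (m + k) (k - c) * weight_norm (n + k) c))"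
    by (rule sum.cong) (simp_all add: weight_norm_symmetric)
  also have "\<dots> = (\<Sum>j\<le>k. ?v ^ (k - j) * ?u ^ j * ?q ^ (j * m) * weight_norm k j ^ 2
          / (weight_norm (m + k) j * weight_norm (n + k) (k - j)))"
    by (rule sum.reindex_bij_witness[of _ "\<lambda>j. k - j" "\<lambda>j. k - j"]) auto
  also have "\<dots> = (\<Sum>j\<le>k. ?v ^ k * (p k ^ 2 * p m * p n / (p (m + k) * p (n + k))) *
      (?q ^ (Suc m * j) * gauss n j * gauss m (k - j)))"
  proof (rule sum.cong)
    fix j assume "j \<in> {..k}"
    then obtain d where k: "k = j + d" by (auto simp: le_iff_add)
    \<comment> \<open>Since \<open>?u = ?v * ?q\<close>, the total power of \<open>?v\<close> is
      \<open>k\<close>; the further \<open>?q ^ j\<close> joins \<open>?q ^ (j * m)\<close> to give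
      the exponent \<open>Suc m * j\<close> of the q-Vandermonde sum.\<close>
    have pow: "?v ^ (k - j) * ?u ^ j * ?q ^ (j * m) = ?v ^ k * ?q ^ (Suc m * j)"
      unfolding vq[symmetric] power_mult_distrib k by (simp add: power_add ac_simps)
    have W: "weight_norm (m + k) j = p (m + k) / (p j * p (m + d))"
        "weight_norm (n + k) (k - j) = p (n + k) / (p d * p (n + j))"
        "weight_norm k j = p k / (p j * p d)"
      using norm(1)[of j "m + d"] norm(1)[of d "n + j"] norm(1)[of j d] by (simp_all add: k ac_simps)
    have G: "gauss n j = p (n + j) / (p j * p n)" "gauss m (k - j) = p (m + d) / (p d * p m)"
      by (simp_all add: norm(2) k)
    show "?v ^ (k - j) * ?u ^ j * ?q ^ (j * m) * weight_norm k j ^ 2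
          / (weight_norm (m + k) j * weight_norm (n + k) (k - j))
        = ?v ^ k * (p k ^ 2 * p m * p n / (p (m + k) * p (n + k))) *
          (?q ^ (Suc m * j) * gauss n j * gauss m (k - j))"
      unfolding pow W G using nz by (simp add: divide_simps power2_eq_square)
  qed simp
  also have "\<dots> = ?v ^ k * (p k ^ 2 * p m * p n / (p (m + k) * p (n + k))) * gauss (Suc (n + m)) k"
    unfolding sum_distrib_left[symmetric] gauss_vandermonde ..
  also have "\<dots> = ?v ^ k * (p k * p m * p n * p (Suc (m + n + k)) / (p (m + k) * p (n + k) * p (Suc (m + n))))"
    using nz by (simp add: norm(2) power2_eq_square divide_simps add.commute[of n m])
  finally show ?thesis
    unfolding theta_inner_vacuum .
qed

text \<open>Up to a power of \<open>?v\<close> and the factor \<open>1 - ?q\<close>,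
  \<open>Delta (int j)\<close> is the quotient of \<open>p (Suc j)\<close> by \<open>p j\<close>, so
  products over consecutive indices telescope. There are as many factors above as below, which
  removes \<open>1 - ?q\<close>.\<close>

lemma ceil_symbol_value:
  fixes m n k :: nat
  defines "p \<equiv> q_pochhammer (Avar ^ 4) (Avar ^ 4)"
  shows "ceil_symbol m n k k 0 =
    (- inverse (Avar ^ 2)) ^ k * (p k * p m * p n * p (Suc (m + n + k)) / (p (m + k) * p (n + k) * p (Suc (m + n))))"
proof -
  let ?v = "- inverse (Avar ^ 2)" and ?q = "Avar ^ 4"
  have nz: "p j \<noteq> 0" for j
    by (simp add: p_def q_pochhammer_nonzero)
  have q: "1 - ?q \<noteq> 0" by (simp add: Avar_power_eq_1_iff)
  have D: "Delta (int j) = ?v ^ j * (p (Suc j) / (p j * (1 - ?q)))" for j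
    using nz[of j] unfolding Delta_of_nat power_minus[of "inverse (Avar ^ 2)"]
    by (simp add: p_def q_pochhammer_Suc)
  \<comment> \<open>Running through the factors backwards makes the indices increase from
    \<open>a\<close>, so that raising \<open>k\<close> only appends a factor.\<close>
  have reindex: "(\<Prod>j<k. Delta (int a + int k - int j - 1)) = (\<Prod>j<k. Delta (int (a + j)))" for a
  proof -
    have "(\<Prod>j<k. Delta (int a + int k - int j - 1)) = (\<Prod>j<k. Delta (int (a + (k - Suc j))))"
      by (rule prod.cong) (auto simp: of_nat_diff algebra_simps)
    also have "\<dots> = (\<Prod>j<k. Delta (int (a + j)))"
      by (rule prod.nat_diff_reindex)
    finally show ?thesis .
  qed
  have reindex': "(\<Prod>j<k. Delta (int m + int n + int k - int j)) = (\<Prod>j<k. Delta (int (Suc (m + n) + j)))"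
    using reindex[of "Suc (m + n)"] by (simp add: algebra_simps)
  have "ceil_symbol m n k k 0 = (\<Prod>j<k. Delta (int (0 + j))) / ((\<Prod>j<k. Delta (int (n + j))) * (\<Prod>j<k. Delta (int (m + j))))
      * (\<Prod>j<k. Delta (int (Suc (m + n) + j)))"
    unfolding reindex'[symmetric] unfolding reindex[symmetric]
    using nz[of k] nz[of 0] by (simp add: ceil_symbol_def q_binomial_def prod.distrib p_def q_pochhammer_def)
  also have "\<dots> = ?v ^ k * (p k * p m * p n * p (Suc (m + n + k)) / (p (m + k) * p (n + k) * p (Suc (m + n))))"
  proof (induction k)
    case 0
    have "p 0 = 1" by (simp add: p_def q_pochhammer_def)
    then show ?case using nz by simp
  next
    case (Suc k)
    \<comment> \<open>The exponents of \<open>?v\<close> add up to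
      \<open>k + (m + n + 1 + k) - (n + k) - (m + k) = 1\<close>, hence one factor \<open>?v\<close>
      for each step.\<close>
    have ratio: "Delta (int k) / (Delta (int (n + k)) * Delta (int (m + k))) * Delta (int (Suc (m + n) + k))
        = ?v * (p (Suc k) / p k * (p (n + k) / p (Suc (n + k))) * (p (m + k) / p (Suc (m + k)))
          * (p (Suc (Suc (m + n + k))) / p (Suc (m + n + k))))"
    proof -
      have "?v \<noteq> 0" by simp
      then show ?thesis
        unfolding D using nz q by (simp add: power_add divide_simps)
    qed
    have "(\<Prod>j<Suc k. Delta (int (0 + j))) / ((\<Prod>j<Suc k. Delta (int (n + j))) * (\<Prod>j<Suc k. Delta (int (m + j))))
        * (\<Prod>j<Suc k. Delta (int (Suc (m + n) + j)))
      = (\<Prod>j<k. Delta (int (0 + j))) / ((\<Prod>j<k. Delta (int (n + j))) * (\<Prod>j<k. Delta (int (m + j))))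
        * (\<Prod>j<k. Delta (int (Suc (m + n) + j)))
        * (Delta (int k) / (Delta (int (n + k)) * Delta (int (m + k))) * Delta (int (Suc (m + n) + k)))"
      by (simp add: ac_simps)
    also have "\<dots> = ?v ^ k * (p k * p m * p n * p (Suc (m + n + k)) / (p (m + k) * p (n + k) * p (Suc (m + n))))
        * (?v * (p (Suc k) / p k * (p (n + k) / p (Suc (n + k))) * (p (m + k) / p (Suc (m + k)))
          * (p (Suc (Suc (m + n + k))) / p (Suc (m + n + k)))))"
      unfolding Suc ratio ..
    also have "\<dots> = ?v ^ Suc k * (p (Suc k) * p m * p n * p (Suc (m + n + Suc k))
        / (p (m + Suc k) * p (n + Suc k) * p (Suc (m + n))))"
      using nz by (simp add: divide_simps)
    finally show ?case .
  qed
  finally show ?thesis .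
qed

theorem proposition3p2:
  fixes m n k :: nat
  shows "sphere_eval (theta m n k) = ceil_symbol m n k k 0 * Delta (int m + int n)"
  using sphere_eval_eq[OF theta_in_tangle_combs] comb_op_theta theta_inner_value ceil_symbol_value by simp

end
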